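(* Let $V$ be a finite dimensional vector space over a field $K$. The category $\mathbb V$ of subspaces of $V$ is normal and bounded above. In particular, the poset of $\mathscr R$-classes in the semigroup $\widehat{\mathbb V}$ is isomorphic to the poset $\mathfrak N$ of null spaces of $V$, and so $\mathbb V_{\mathfrak N}$ is a connected category. The normal category $\mathbb L(\mathscr{LT}_V)$ of the monoid $\mathscr{LT}_V$ of all linear transformations of $V$ is isomorphic to $\mathbb V$, as bounded above categories.
   Context: Conventions. Mappings, morphisms and functors are composed from left to right ($fg$ means first $f$, then $g$). For a category $\mathcal C$, $v\mathcal C$ denotes its class of objects and $\mathcal C(c,c')$ the set of morphisms from $c$ to $c'$. A monomorphism is a right cancellable morphism and an epimorphism is a left cancellable morphism. A semigroup $S$ is regular if for every $a\in S$ there is $x\in S$ with $axa=a$; $E(S)$ is its set of idempotents. Normal categories. A strict preorder is a category with at most one morphism between any two (possibly equal) objects in which the only isomorphisms are identities. A category with subobjects is a small category $\mathcal C$ with a subcategory $\mathcal P$ such that: $\mathcal P$ is a strict preorder with $v\mathcal P=v\mathcal C$; every $f\in\mathcal P$ is a monomorphism in $\mathcal C$; if $f,g\in\mathcal P$ and $f=hg$ with $h\in\mathcal C$, then $h\in\mathcal P$. Morphisms of $\mathcal P$ are called inclusions; $c\preceq c'$ means $\mathcal P(c,c')\neq\emptyset$, and $j(c,c')$ is then the unique inclusion. An inclusion $j\colon c\to c'$ splits if there is $q\colon c'\to c$ in $\mathcal C$ with $jq=1_c$; such a $q$ is called a retraction. A normal factorisation of a morphism $f$ is $f=quj$ with $q$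 a retraction, $u$ an isomorphism, $j$ an inclusion. A cone with vertex $z\in v\mathcal C$ is a map $\gamma$ assigning to each $c\in v\mathcal C$ a morphism $\gamma(c)\in\mathcal C(c,z)$ such that $j(a,b)\gamma(b)=\gamma(a)$ whenever $a\preceq b$, and $\gamma(c)$ is an isomorphism for at least one $c$; the vertex is denoted $z_\gamma$. $\mathcal C$ is a normal category if it is a category with subobjects in which every inclusion splits, every morphism has a normal factorisation, and for each $c\in v\mathcal C$ there is a cone $\mu$ with vertex $c$ and $\mu(c)=1_c$. In a normal category, for a normal factorisation $f=quj$ the epimorphism $f^\circ:=qu$ does not depend on the factorisation. A normal category $\mathcal C$ is bounded above if there is $d\in v\mathcal C$ with $c\preceq d$ for every $c\in v\mathcal C$. Semigroup of cones. For a cone $\gamma$ and an epimorphism $f$ with domain $z_\gamma$, $\gamma\ast f$ is the cone $c\mapsto\gamma(c)f$. The set $\widehat{\mathcal C}$ of all cones in a normal category $\mathcal C$ is a regular semigroup under $\gamma\cdot\delta=\gamma\ast(\delta(z_\gamma))^\circ$. Let $\mathscr R$ be Green's relation on $\widehat{\mathcal C}$, $R_\gamma$ the $\mathscr R$-class of $\gamma$; $\widehat{\mathcal C}/\mathscr R$ is partially ordered by $R_\gamma\sqsubseteq R_\delta$ iff the principal right ideal generated by $\gamma$ is contained in that generated by $\delta$. Connected categories and CC-morphisms. Let $\mathcal C$ be a normal category and $\mathfrak D$ a down-set of $(\widehat{\mathcal C}/\mathscr R,\sqsubseteq)$. An object $c$ is connected by (or to) $\mathfrak d\in\mathfrak D$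 if $\mathfrak d$ contains an idempotent cone with vertex $c$; this cone is then unique and is denoted $\epsilon(c,\mathfrak d)$. $\mathcal C$ is connected by $\mathfrak D$ if every $c\in v\mathcal C$ is connected by some $\mathfrak d\in\mathfrak D$; then the pair is denoted $\mathcal C_{\mathfrak D}$ and called a connected category. One also writes $\mathcal C_{\mathfrak E}$, and calls it a connected category, when $\mathfrak E$ is a poset identified through an order isomorphism with such a down-set $\mathfrak D$. A CC-morphism from $\mathcal C_{\mathfrak D}$ to $\mathcal C'_{\mathfrak D'}$ is a pair $(F,G)$ where $F\colon\mathcal C\to\mathcal C'$ is an inclusion preserving functor and $G\colon\mathfrak D\to\mathfrak D'$ is an order preserving map such that whenever $c$ is connected to $\mathfrak d$, $F(c)$ is connected to $G(\mathfrak d)$ and $F(\epsilon(c,\mathfrak d)(c'))=\epsilon(F(c),G(\mathfrak d))(F(c'))$ for every $c'\in v\mathcal C$. Every normal category $\mathcal C$ is treated as the connected category with $\mathfrak D=\widehat{\mathcal C}/\mathscr R$; "isomorphic as bounded above categories" means isomorphic in the category of bounded above normal categories with CC-morphisms. The categories involved. For a regular semigroup $S$, $\mathbb L(S)$ is the category whose objects are the principal left ideals $Se$ ($e\in E(S)$) and whose morphisms from $Se$ to $Sf$ are the mappings $r(e,u,f)\colon Se\to Sf$, $x\mapsto xu$, for $u\in eSf$, composed as maps; its inclusions are the morphisms $r(e,e,f)$ for $Se\subseteq Sf$; it is a normal category. $\mathscr{LT}_V$ is the regular monoid of all linear maps $V\to V$ under (left-to-right) composition. $\mathbb V$ is the category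 whose objects are all subspaces of $V$ and whose morphisms from $A$ to $B$ are all linear maps $A\to B$; its inclusions are the subspace inclusion maps. $\mathfrak N$ is the set of null spaces (kernels) of linear transformations of $V$, ordered by reverse inclusion. *)

theory Defs
  imports Complex_Main "HOL-Library.FuncSet"
begin

section \<open>Categories with subobjects\<close>

text \<open>Composition is written in diagrammatic order: \<open>Cmp C f g\<close> is first \<open>f\<close>, then \<open>g\<close>.
  Operations of a record are only constrained on its objects and arrows.\<close>

record ('o, 'm) cat =
  Ob :: "'o set"
  Ar :: "'m set"
  Dom :: "'m \<Rightarrow> 'o"
  Cod :: "'m \<Rightarrow> 'o"
  Idn :: "'o \<Rightarrow> 'm"
  Cmp :: "'m \<Rightarrow> 'm \<Rightarrow> 'm"

definition Hom :: "('o, 'm, 'x) cat_scheme \<Rightarrow> 'o \<Rightarrow> 'o \<Rightarrow> 'm set" where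
  "Hom C a b = {f \<in> Ar C. Dom C f = a \<and> Cod C f = b}"

locale category =
  fixes C :: "('o, 'm, 'x) cat_scheme"
  assumes Dom_in: "f \<in> Ar C \<Longrightarrow> Dom C f \<in> Ob C"
    and Cod_in: "f \<in> Ar C \<Longrightarrow> Cod C f \<in> Ob C"
    and Idn_in: "a \<in> Ob C \<Longrightarrow> Idn C a \<in> Hom C a a"
    and Cmp_in: "f \<in> Hom C a b \<Longrightarrow> g \<in> Hom C b c \<Longrightarrow> Cmp C f g \<in> Hom C a c"
    and Idn_left: "f \<in> Hom C a b \<Longrightarrow> Cmp C (Idn C a) f = f"
    and Idn_right: "f \<in> Hom C a b \<Longrightarrow> Cmp C f (Idn C b) = f"
    and Cmp_assoc: "f \<in> Hom C a b \<Longrightarrow> g \<in> Hom C b c \<Longrightarrow> h \<in> Hom C c d \<Longrightarrow>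
      Cmp C (Cmp C f g) h = Cmp C f (Cmp C g h)"

definition monomorphism :: "('o, 'm, 'x) cat_scheme \<Rightarrow> 'm \<Rightarrow> bool" where
  "monomorphism C f \<longleftrightarrow> f \<in> Ar C \<and>
     (\<forall>a\<in>Ob C. \<forall>g\<in>Hom C a (Dom C f). \<forall>h\<in>Hom C a (Dom C f).
        Cmp C g f = Cmp C h f \<longrightarrow> g = h)"

definition isomorphism :: "('o, 'm, 'x) cat_scheme \<Rightarrow> 'm \<Rightarrow> bool" where
  "isomorphism C f \<longleftrightarrow> f \<in> Ar C \<and>
     (\<exists>g\<in>Hom C (Cod C f) (Dom C f).
        Cmp C f g = Idn C (Dom C f) \<and> Cmp C g f = Idn C (Cod C f))"

definition strict_preorder :: "('o, 'm, 'x) cat_scheme \<Rightarrow> bool" where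
  "strict_preorder P \<longleftrightarrow> category P \<and>
     (\<forall>a\<in>Ob P. \<forall>b\<in>Ob P. \<forall>f\<in>Hom P a b. \<forall>g\<in>Hom P a b. f = g) \<and>
     (\<forall>f\<in>Ar P. isomorphism P f \<longrightarrow> f = Idn P (Dom P f))"

text \<open>The subcategory of inclusions has all objects, so it is given by its set \<open>Inc\<close> of arrows.\<close>

record ('o, 'm) subobj_cat = "('o, 'm) cat" +
  Inc :: "'m set"

definition inclusion_cat :: "('o, 'm, 'x) subobj_cat_scheme \<Rightarrow> ('o, 'm) cat" where
  "inclusion_cat C = \<lparr>Ob = Ob C, Ar = Inc C, Dom = Dom C, Cod = Cod C, Idn = Idn C, Cmp = Cmp C\<rparr>"

locale category_with_subobjects = category C
  for C :: "('o, 'm, 'x) subobj_cat_scheme" +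
  assumes Inc_subset: "Inc C \<subseteq> Ar C"
    and Inc_strict_preorder: "strict_preorder (inclusion_cat C)"
    and Inc_mono: "f \<in> Inc C \<Longrightarrow> monomorphism C f"
    and Inc_factor: "f \<in> Inc C \<Longrightarrow> g \<in> Inc C \<Longrightarrow> h \<in> Hom C (Dom C f) (Dom C g) \<Longrightarrow>
      f = Cmp C h g \<Longrightarrow> h \<in> Inc C"

definition subobj_le :: "('o, 'm, 'x) subobj_cat_scheme \<Rightarrow> 'o \<Rightarrow> 'o \<Rightarrow> bool" where
  "subobj_le C a b \<longleftrightarrow> Inc C \<inter> Hom C a b \<noteq> {}"

definition incl :: "('o, 'm, 'x) subobj_cat_scheme \<Rightarrow> 'o \<Rightarrow> 'o \<Rightarrow> 'm" where
  "incl C a b = (THE j. j \<in> Inc C \<inter> Hom C a b)"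

definition retraction_of :: "('o, 'm, 'x) subobj_cat_scheme \<Rightarrow> 'm \<Rightarrow> 'm \<Rightarrow> bool" where
  "retraction_of C j q \<longleftrightarrow> q \<in> Hom C (Cod C j) (Dom C j) \<and> Cmp C j q = Idn C (Dom C j)"

definition retraction :: "('o, 'm, 'x) subobj_cat_scheme \<Rightarrow> 'm \<Rightarrow> bool" where
  "retraction C q \<longleftrightarrow> (\<exists>j\<in>Inc C. retraction_of C j q)"

definition normal_factorisation ::
  "('o, 'm, 'x) subobj_cat_scheme \<Rightarrow> 'm \<Rightarrow> 'm \<Rightarrow> 'm \<Rightarrow> 'm \<Rightarrow> bool" where
  "normal_factorisation C f q u j \<longleftrightarrow>
     retraction C q \<and> isomorphism C u \<and> j \<in> Inc C \<and>
     Dom C q = Dom C f \<and> Cod C q = Dom C u \<and> Cod C u = Dom C j \<and> Cod C j = Cod C f \<and>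
     f = Cmp C (Cmp C q u) j"

definition epi_part :: "('o, 'm, 'x) subobj_cat_scheme \<Rightarrow> 'm \<Rightarrow> 'm" where
  "epi_part C f = (THE e. \<exists>q u j. normal_factorisation C f q u j \<and> e = Cmp C q u)"


section \<open>Cones and normal categories\<close>

text \<open>Cones are made \<open>undefined\<close> outside the objects, so that equality of cones is equality of
  the maps on objects.\<close>

definition is_cone :: "('o, 'm, 'x) subobj_cat_scheme \<Rightarrow> 'o \<Rightarrow> ('o \<Rightarrow> 'm) \<Rightarrow> bool" where
  "is_cone C z \<gamma> \<longleftrightarrow> z \<in> Ob C \<and> \<gamma> \<in> extensional (Ob C) \<and>
     (\<forall>c\<in>Ob C. \<gamma> c \<in> Hom C c z) \<and>
     (\<forall>a\<in>Ob C. \<forall>b\<in>Ob C. subobj_le C a b \<longrightarrow> Cmp C (incl C a b) (\<gamma> b) = \<gamma> a) \<and>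
     (\<exists>c\<in>Ob C. isomorphism C (\<gamma> c))"

definition vertex :: "('o, 'm, 'x) subobj_cat_scheme \<Rightarrow> ('o \<Rightarrow> 'm) \<Rightarrow> 'o" where
  "vertex C \<gamma> = (THE z. is_cone C z \<gamma>)"

locale normal_category = category_with_subobjects C
  for C :: "('o, 'm, 'x) subobj_cat_scheme" +
  assumes Inc_splits: "j \<in> Inc C \<Longrightarrow> \<exists>q. retraction_of C j q"
    and has_normal_factorisation: "f \<in> Ar C \<Longrightarrow> \<exists>q u j. normal_factorisation C f q u j"
    and has_cone: "c \<in> Ob C \<Longrightarrow> \<exists>\<mu>. is_cone C c \<mu> \<and> \<mu> c = Idn C c"

definition bounded_above :: "('o, 'm, 'x) subobj_cat_scheme \<Rightarrow> bool" where
  "bounded_above C \<longleftrightarrow> (\<exists>d\<in>Ob C. \<forall>c\<in>Ob C. subobj_le C c d)"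


section \<open>Semigroups and Green's relation R\<close>

record 'a sgrp =
  Car :: "'a set"
  Mul :: "'a \<Rightarrow> 'a \<Rightarrow> 'a"

definition idempotents :: "'a sgrp \<Rightarrow> 'a set" where
  "idempotents S = {e \<in> Car S. Mul S e e = e}"

text \<open>Principal right ideals are formed with an identity adjoined.\<close>

definition principal_right :: "'a sgrp \<Rightarrow> 'a \<Rightarrow> 'a set" where
  "principal_right S a = insert a {Mul S a x | x. x \<in> Car S}"

definition green_R :: "'a sgrp \<Rightarrow> ('a \<times> 'a) set" where
  "green_R S = {(a, b). a \<in> Car S \<and> b \<in> Car S \<and> principal_right S a = principal_right S b}"

definition R_classes :: "'a sgrp \<Rightarrow> 'a set set" where
  "R_classes S = Car S // green_R S"

text \<open>On R-classes this does not depend on the representatives.\<close>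

definition R_le :: "'a sgrp \<Rightarrow> 'a set \<Rightarrow> 'a set \<Rightarrow> bool" where
  "R_le S X Y \<longleftrightarrow> (\<exists>a\<in>X. \<exists>b\<in>Y. principal_right S a \<subseteq> principal_right S b)"

definition cone_comp :: "('o, 'm, 'x) subobj_cat_scheme \<Rightarrow> ('o \<Rightarrow> 'm) \<Rightarrow> 'm \<Rightarrow> ('o \<Rightarrow> 'm)" where
  "cone_comp C \<gamma> f = (\<lambda>c\<in>Ob C. Cmp C (\<gamma> c) f)"

definition cone_sgrp :: "('o, 'm, 'x) subobj_cat_scheme \<Rightarrow> ('o \<Rightarrow> 'm) sgrp" where
  "cone_sgrp C = \<lparr>Car = {\<gamma>. \<exists>z. is_cone C z \<gamma>},
                  Mul = (\<lambda>\<gamma> \<delta>. cone_comp C \<gamma> (epi_part C (\<delta> (vertex C \<gamma>))))\<rparr>"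

abbreviation cone_classes :: "('o, 'm, 'x) subobj_cat_scheme \<Rightarrow> ('o \<Rightarrow> 'm) set set" where
  "cone_classes C \<equiv> R_classes (cone_sgrp C)"

abbreviation cone_class_le ::
  "('o, 'm, 'x) subobj_cat_scheme \<Rightarrow> ('o \<Rightarrow> 'm) set \<Rightarrow> ('o \<Rightarrow> 'm) set \<Rightarrow> bool" where
  "cone_class_le C \<equiv> R_le (cone_sgrp C)"


section \<open>Connected categories\<close>

definition connected_to :: "('o, 'm, 'x) subobj_cat_scheme \<Rightarrow> 'o \<Rightarrow> ('o \<Rightarrow> 'm) set \<Rightarrow> bool" where
  "connected_to C c \<dd> \<longleftrightarrow> (\<exists>\<gamma>\<in>\<dd>. \<gamma> \<in> idempotents (cone_sgrp C) \<and> vertex C \<gamma> = c)"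

definition idem_cone :: "('o, 'm, 'x) subobj_cat_scheme \<Rightarrow> 'o \<Rightarrow> ('o \<Rightarrow> 'm) set \<Rightarrow> ('o \<Rightarrow> 'm)" where
  "idem_cone C c \<dd> = (THE \<gamma>. \<gamma> \<in> \<dd> \<and> \<gamma> \<in> idempotents (cone_sgrp C) \<and> vertex C \<gamma> = c)"

definition down_set :: "'a set \<Rightarrow> ('a \<Rightarrow> 'a \<Rightarrow> bool) \<Rightarrow> 'a set \<Rightarrow> bool" where
  "down_set A le D \<longleftrightarrow> D \<subseteq> A \<and> (\<forall>x\<in>D. \<forall>y\<in>A. le y x \<longrightarrow> y \<in> D)"

definition connected_category ::
  "('o, 'm, 'x) subobj_cat_scheme \<Rightarrow> ('o \<Rightarrow> 'm) set set \<Rightarrow> bool" where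
  "connected_category C D \<longleftrightarrow> normal_category C \<and>
     down_set (cone_classes C) (cone_class_le C) D \<and>
     (\<forall>c\<in>Ob C. \<exists>\<dd>\<in>D. connected_to C c \<dd>)"

definition order_iso ::
  "'a set \<Rightarrow> ('a \<Rightarrow> 'a \<Rightarrow> bool) \<Rightarrow> 'b set \<Rightarrow> ('b \<Rightarrow> 'b \<Rightarrow> bool) \<Rightarrow> ('a \<Rightarrow> 'b) \<Rightarrow> bool" where
  "order_iso A leA B leB \<theta> \<longleftrightarrow> bij_betw \<theta> A B \<and>
     (\<forall>x\<in>A. \<forall>y\<in>A. leA x y \<longleftrightarrow> leB (\<theta> x) (\<theta> y))"

text \<open>A poset \<open>(E, le)\<close> in place of a down-set, identified with one through \<open>\<theta>\<close>.\<close>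

definition connected_category_via ::
  "('o, 'm, 'x) subobj_cat_scheme \<Rightarrow> 'e set \<Rightarrow> ('e \<Rightarrow> 'e \<Rightarrow> bool) \<Rightarrow>
   ('e \<Rightarrow> ('o \<Rightarrow> 'm) set) \<Rightarrow> bool" where
  "connected_category_via C E le \<theta> \<longleftrightarrow>
     (\<exists>D. connected_category C D \<and> order_iso E le D (cone_class_le C) \<theta>)"


section \<open>The category of CC-morphisms\<close>

text \<open>All component maps are extensional (\<open>undefined\<close> outside their domains), so that equality
  of CC-morphisms is equality of records.\<close>

record ('o, 'm, 'p, 'n) fnctr =
  on_Ob :: "'o \<Rightarrow> 'p"
  on_Ar :: "'m \<Rightarrow> 'n"

definition is_fnctr ::
  "('o, 'm, 'x) cat_scheme \<Rightarrow> ('p, 'n, 'y) cat_scheme \<Rightarrow> ('o, 'm, 'p, 'n) fnctr \<Rightarrow> bool" where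
  "is_fnctr C C' F \<longleftrightarrow>
     on_Ob F \<in> Ob C \<rightarrow>\<^sub>E Ob C' \<and> on_Ar F \<in> Ar C \<rightarrow>\<^sub>E Ar C' \<and>
     (\<forall>f\<in>Ar C. on_Ar F f \<in> Hom C' (on_Ob F (Dom C f)) (on_Ob F (Cod C f))) \<and>
     (\<forall>c\<in>Ob C. on_Ar F (Idn C c) = Idn C' (on_Ob F c)) \<and>
     (\<forall>f\<in>Ar C. \<forall>g\<in>Ar C. Cod C f = Dom C g \<longrightarrow>
        on_Ar F (Cmp C f g) = Cmp C' (on_Ar F f) (on_Ar F g))"

definition CC_morphism ::
  "('o, 'm, 'x) subobj_cat_scheme \<Rightarrow> ('o \<Rightarrow> 'm) set set \<Rightarrow>
   ('p, 'n, 'y) subobj_cat_scheme \<Rightarrow> ('p \<Rightarrow> 'n) set set \<Rightarrow>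
   ('o, 'm, 'p, 'n) fnctr \<times> (('o \<Rightarrow> 'm) set \<Rightarrow> ('p \<Rightarrow> 'n) set) \<Rightarrow> bool" where
  "CC_morphism C D C' D' = (\<lambda>(F, G).
     connected_category C D \<and> connected_category C' D' \<and>
     is_fnctr C C' F \<and> on_Ar F ` Inc C \<subseteq> Inc C' \<and>
     G \<in> D \<rightarrow>\<^sub>E D' \<and> monotone_on D (cone_class_le C) (cone_class_le C') G \<and>
     (\<forall>c\<in>Ob C. \<forall>\<dd>\<in>D. connected_to C c \<dd> \<longrightarrow>
        connected_to C' (on_Ob F c) (G \<dd>) \<and>
        (\<forall>c'\<in>Ob C. on_Ar F (idem_cone C c \<dd> c') = idem_cone C' (on_Ob F c) (G \<dd>) (on_Ob F c'))))"

definition CC_id ::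
  "('o, 'm, 'x) subobj_cat_scheme \<Rightarrow> ('o \<Rightarrow> 'm) set set \<Rightarrow>
   ('o, 'm, 'o, 'm) fnctr \<times> (('o \<Rightarrow> 'm) set \<Rightarrow> ('o \<Rightarrow> 'm) set)" where
  "CC_id C D = (\<lparr>on_Ob = (\<lambda>c\<in>Ob C. c), on_Ar = (\<lambda>f\<in>Ar C. f)\<rparr>, (\<lambda>\<dd>\<in>D. \<dd>))"

text \<open>\<open>CC_comp C D \<Phi> \<Psi>\<close> is first \<open>\<Phi>\<close>, with domain \<open>(C, D)\<close>, then \<open>\<Psi>\<close>; the library's
  \<open>compose A g f\<close> is first \<open>f\<close>, then \<open>g\<close>.\<close>

definition CC_comp ::
  "('o, 'm, 'x) subobj_cat_scheme \<Rightarrow> ('o \<Rightarrow> 'm) set set \<Rightarrow>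
   ('o, 'm, 'p, 'n) fnctr \<times> (('o \<Rightarrow> 'm) set \<Rightarrow> ('p \<Rightarrow> 'n) set) \<Rightarrow>
   ('p, 'n, 'q, 'l) fnctr \<times> (('p \<Rightarrow> 'n) set \<Rightarrow> ('q \<Rightarrow> 'l) set) \<Rightarrow>
   ('o, 'm, 'q, 'l) fnctr \<times> (('o \<Rightarrow> 'm) set \<Rightarrow> ('q \<Rightarrow> 'l) set)" where
  "CC_comp C D = (\<lambda>(F, G) (F', G').
     (\<lparr>on_Ob = compose (Ob C) (on_Ob F') (on_Ob F),
       on_Ar = compose (Ar C) (on_Ar F') (on_Ar F)\<rparr>,
      compose D G' G))"

definition CC_isomorphic ::
  "('o, 'm, 'x) subobj_cat_scheme \<Rightarrow> ('o \<Rightarrow> 'm) set set \<Rightarrow>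
   ('p, 'n, 'y) subobj_cat_scheme \<Rightarrow> ('p \<Rightarrow> 'n) set set \<Rightarrow> bool" where
  "CC_isomorphic C D C' D' \<longleftrightarrow>
     (\<exists>\<Phi> \<Psi>. CC_morphism C D C' D' \<Phi> \<and> CC_morphism C' D' C D \<Psi> \<and>
            CC_comp C D \<Phi> \<Psi> = CC_id C D \<and> CC_comp C' D' \<Psi> \<Phi> = CC_id C' D')"

text \<open>A normal category is taken as connected by all R-classes of cones.\<close>

definition isomorphic_as_bounded_above ::
  "('o, 'm, 'x) subobj_cat_scheme \<Rightarrow> ('p, 'n, 'y) subobj_cat_scheme \<Rightarrow> bool" where
  "isomorphic_as_bounded_above C C' \<longleftrightarrow>
     normal_category C \<and> bounded_above C \<and> normal_category C' \<and> bounded_above C' \<and>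
     CC_isomorphic C (cone_classes C) C' (cone_classes C')"


section \<open>Categories of sets and maps\<close>

text \<open>An arrow is a triple \<open>(A, f, B)\<close> with \<open>f\<close> a map from \<open>A\<close> to \<open>B\<close> that is \<open>undefined\<close>
  outside \<open>A\<close>.\<close>

type_synonym 'a arrow = "'a set \<times> ('a \<Rightarrow> 'a) \<times> 'a set"

definition map_cat :: "'a set set \<Rightarrow> 'a arrow set \<Rightarrow> 'a arrow set \<Rightarrow> ('a set, 'a arrow) subobj_cat" where
  "map_cat Obs Ars Incs =
     \<lparr>Ob = Obs, Ar = Ars, Dom = (\<lambda>(A, f, B). A), Cod = (\<lambda>(A, f, B). B),
      Idn = (\<lambda>A. (A, (\<lambda>x\<in>A. x), A)),
      Cmp = (\<lambda>(A, f, B) (B', g, D). (A, compose A g f, D)),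
      Inc = Incs\<rparr>"

definition principal_left :: "'a sgrp \<Rightarrow> 'a \<Rightarrow> 'a set" where
  "principal_left S e = {Mul S x e | x. x \<in> Car S}"

definition right_translation :: "'a sgrp \<Rightarrow> 'a \<Rightarrow> 'a \<Rightarrow> 'a \<Rightarrow> 'a arrow" where
  "right_translation S e u f =
     (principal_left S e, (\<lambda>x\<in>principal_left S e. Mul S x u), principal_left S f)"

text \<open>The category \<open>\<L>(S)\<close> of principal left ideals generated by idempotents of a regular
  semigroup.\<close>

definition left_ideal_cat :: "'a sgrp \<Rightarrow> ('a set, 'a arrow) subobj_cat" where
  "left_ideal_cat S = map_cat
     (principal_left S ` idempotents S)
     {right_translation S e u f | e u f. e \<in> idempotents S \<and> f \<in> idempotents S \<and>
        u \<in> {Mul S (Mul S e s) f | s. s \<in> Car S}}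
     {right_translation S e e f | e f. e \<in> idempotents S \<and> f \<in> idempotents S \<and>
        principal_left S e \<subseteq> principal_left S f}"


section \<open>Linear transformations and subspaces of a vector space\<close>

text \<open>The vector space \<open>V\<close> is the whole type \<open>'v\<close>, with scalar multiplication \<open>scale\<close>.\<close>

definition LT_sgrp :: "('k::field \<Rightarrow> 'v::ab_group_add \<Rightarrow> 'v) \<Rightarrow> ('v \<Rightarrow> 'v) sgrp" where
  "LT_sgrp scale = \<lparr>Car = {T. Vector_Spaces.linear scale scale T}, Mul = (\<lambda>S T. T \<circ> S)\<rparr>"

definition linear_maps ::
  "('k::field \<Rightarrow> 'v::ab_group_add \<Rightarrow> 'v) \<Rightarrow> 'v set \<Rightarrow> 'v set \<Rightarrow> ('v \<Rightarrow> 'v) set" where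
  "linear_maps scale A B = {f \<in> A \<rightarrow>\<^sub>E B.
     (\<forall>x\<in>A. \<forall>y\<in>A. f (x + y) = f x + f y) \<and> (\<forall>c. \<forall>x\<in>A. f (scale c x) = scale c (f x))}"

definition subspace_cat ::
  "('k::field \<Rightarrow> 'v::ab_group_add \<Rightarrow> 'v) \<Rightarrow> ('v set, 'v arrow) subobj_cat" where
  "subspace_cat scale = map_cat
     {A. module.subspace scale A}
     {(A, f, B) | A f B. module.subspace scale A \<and> module.subspace scale B \<and>
        f \<in> linear_maps scale A B}
     {(A, (\<lambda>x\<in>A. x), B) | A B. module.subspace scale A \<and> module.subspace scale B \<and> A \<subseteq> B}"

definition null_spaces :: "('k::field \<Rightarrow> 'v::ab_group_add \<Rightarrow> 'v) \<Rightarrow> 'v set set" where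
  "null_spaces scale = {{x. T x = 0} | T. Vector_Spaces.linear scale scale T}"

end

theory Submission
  imports Defs
begin

text \<open>A cone in the category \<open>\<V>\<close> of subspaces is determined by its component at \<open>V\<close>, a linear map
  of \<open>V\<close> onto the vertex, and every linear transformation arises in this way. Under this
  correspondence the cones form the monoid of linear transformations, idempotent cones become projections, and the
  principal right ideal of \<open>T\<close> consists of the transformations that vanish on the kernel of \<open>T\<close>;
  hence R-classes correspond to null spaces, with the order reversed. The principal left ideal of
  an idempotent \<open>E\<close> consists of the transformations with values in the image of \<open>E\<close>, so
  \<open>A \<mapsto> {T. range T \<subseteq> A}\<close> together with postcomposition is an isomorphism from \<open>\<V>\<close> to the category \<open>\<L>\<close> of ideals
  carrying inclusions to inclusions. All the notions involved, including the R-classes of cones,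
  are invariant under such an isomorphism, which therefore makes \<open>\<L>\<close> normal and bounded above
  and yields the isomorphism of connected categories.\<close>

section \<open>Categories with subobjects\<close>

lemma HomD: "f \<in> Hom C a b \<Longrightarrow> f \<in> Ar C \<and> Dom C f = a \<and> Cod C f = b"
  by (simp add: Hom_def)

lemma Hom_selfI: "f \<in> Ar C \<Longrightarrow> f \<in> Hom C (Dom C f) (Cod C f)"
  by (simp add: Hom_def)

context category
begin

lemma Hom_Ob: "f \<in> Hom C a b \<Longrightarrow> a \<in> Ob C \<and> b \<in> Ob C"
  using Dom_in Cod_in by (auto simp: Hom_def)

lemma isomorphism_has_inverse:
  assumes "isomorphism C u" "u \<in> Hom C a b"
  obtains v where "v \<in> Hom C b a" "Cmp C u v = Idn C a" "Cmp C v u = Idn C b"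
  using assms unfolding isomorphism_def Hom_def by auto

end

lemma is_cone_vertex:
  assumes "is_cone C z \<gamma>"
  shows "vertex C \<gamma> = z"
  unfolding vertex_def
proof (rule the_equality, rule assms)
  fix y assume "is_cone C y \<gamma>"
  then have "\<gamma> z \<in> Hom C z y" "\<gamma> z \<in> Hom C z z"
    using assms by (auto simp: is_cone_def)
  then show "y = z" by (auto simp: Hom_def)
qed

context category_with_subobjects
begin

lemma Inc_unique:
  assumes "i \<in> Inc C" "j \<in> Inc C" "Dom C i = Dom C j" "Cod C i = Cod C j"
  shows "i = j"
proof -
  let ?P = "inclusion_cat C"
  have "Dom C j \<in> Ob ?P" "Cod C j \<in> Ob ?P" "i \<in> Hom ?P (Dom C j) (Cod C j)" "j \<in> Hom ?P (Dom C j) (Cod C j)"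
    using assms Inc_subset Dom_in Cod_in by (auto simp: inclusion_cat_def Hom_def)
  then show ?thesis
    using Inc_strict_preorder unfolding strict_preorder_def by blast
qed

text \<open>In a preorder the two composites are parallel to identities, so the inclusions are
  mutually inverse there; strictness then makes \<open>i\<close> an identity.\<close>

lemma Inc_antisym:
  assumes "i \<in> Inc C \<inter> Hom C a b" "j \<in> Inc C \<inter> Hom C b a"
  shows "a = b"
proof -
  let ?P = "inclusion_cat C"
  interpret P: category ?P
    using Inc_strict_preorder by (simp add: strict_preorder_def)
  have i: "i \<in> Hom ?P a b" and j: "j \<in> Hom ?P b a"
    using assms by (auto simp: Hom_def inclusion_cat_def)
  have ij: "Cmp ?P i j = Idn ?P a" "Cmp ?P j i = Idn ?P b"
    using P.Cmp_in[OF i j] P.Cmp_in[OF j i] P.Idn_in P.Hom_Ob[OF i] Inc_strict_preorder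
    unfolding strict_preorder_def by blast+
  then have "isomorphism ?P i"
    using i j by (auto simp: isomorphism_def Hom_def)
  then have "i = Idn ?P a"
    using i Inc_strict_preorder by (auto simp: strict_preorder_def Hom_def)
  then have "i \<in> Hom ?P a a"
    using P.Idn_in P.Hom_Ob[OF i] by auto
  then show ?thesis
    using i by (simp add: Hom_def)
qed

lemma incl_eq: "j \<in> Inc C \<inter> Hom C a b \<Longrightarrow> incl C a b = j"
  unfolding incl_def by (rule the_equality) (auto simp: Hom_def intro: Inc_unique)

text \<open>With \<open>i\<close> the inclusion that \<open>q\<close> retracts and \<open>v\<close>
  the inverse of \<open>u\<close>, the composite of \<open>v\<close> and \<open>i\<close> is a
  section of the epimorphism \<open>Cmp C q u\<close>.\<close>

lemma normal_factorisation_section: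
  assumes "normal_factorisation C f q u j"
  obtains s where "s \<in> Hom C (Dom C j) (Dom C f)" "Cmp C s (Cmp C q u) = Idn C (Dom C j)"
    "Cmp C q u \<in> Hom C (Dom C f) (Dom C j)"
proof -
  let ?c = "Cod C q" and ?b = "Dom C j" and ?a = "Dom C f"
  from assms obtain i where i: "i \<in> Inc C" and iq: "retraction_of C i q"
    and u: "isomorphism C u" and ty: "Dom C q = ?a" "?c = Dom C u" "Cod C u = ?b"
    by (auto simp: normal_factorisation_def retraction_def)
  have uh: "u \<in> Hom C ?c ?b"
    using u ty by (simp add: isomorphism_def Hom_def)
  have q: "q \<in> Hom C ?a ?c" "Cmp C i q = Idn C ?c" and ih: "i \<in> Hom C ?c ?a"
    using iq i Inc_subset ty by (auto simp: retraction_of_def Hom_def)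
  obtain v where v: "v \<in> Hom C ?b ?c" "Cmp C v u = Idn C ?b"
    using isomorphism_has_inverse[OF u uh] by blast
  have "Cmp C (Cmp C v i) (Cmp C q u) = Cmp C v (Cmp C (Cmp C i q) u)"
    using Cmp_assoc[OF v(1) ih Cmp_in[OF q(1) uh]] Cmp_assoc[OF ih q(1) uh] by simp
  also have "\<dots> = Idn C ?b"
    using q(2) v(2) Idn_left[OF uh] by simp
  finally show ?thesis
    using that Cmp_in[OF v(1) ih] Cmp_in[OF q(1) uh] by blast
qed

text \<open>A section of either epimorphism factors its inclusion through the other one, so by
  antisymmetry the two images agree.\<close>

lemma normal_factorisation_unique_epi:
  assumes "normal_factorisation C f q u j" "normal_factorisation C f q' u' j'"
  shows "Cmp C q u = Cmp C q' u'"
proof -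
  let ?e = "Cmp C q u" and ?e' = "Cmp C q' u'"
  obtain s where s: "s \<in> Hom C (Dom C j) (Dom C f)" "Cmp C s ?e = Idn C (Dom C j)"
      "?e \<in> Hom C (Dom C f) (Dom C j)"
    using normal_factorisation_section[OF assms(1)] .
  obtain s' where s': "s' \<in> Hom C (Dom C j') (Dom C f)" "Cmp C s' ?e' = Idn C (Dom C j')"
      "?e' \<in> Hom C (Dom C f) (Dom C j')"
    using normal_factorisation_section[OF assms(2)] .
  have I: "j \<in> Inc C" "j' \<in> Inc C" and f: "Cmp C ?e j = Cmp C ?e' j'"
    and cod: "Cod C j = Cod C j'"
    using assms by (auto simp: normal_factorisation_def)
  have j: "j \<in> Hom C (Dom C j) (Cod C j)" and j': "j' \<in> Hom C (Dom C j') (Cod C j)"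
    using I Inc_subset cod by (auto simp: Hom_def)
  have "j = Cmp C (Cmp C s ?e') j'"
    using Cmp_assoc[OF s(1,3) j] Cmp_assoc[OF s(1) s'(3) j'] s(2) f Idn_left[OF j] by simp
  then have 1: "Cmp C s ?e' \<in> Inc C \<inter> Hom C (Dom C j) (Dom C j')"
    using Inc_factor[OF I Cmp_in[OF s(1) s'(3)]] Cmp_in[OF s(1) s'(3)] by blast
  have "j' = Cmp C (Cmp C s' ?e) j"
    using Cmp_assoc[OF s'(1,3) j'] Cmp_assoc[OF s'(1) s(3) j] s'(2) f Idn_left[OF j'] by simp
  then have 2: "Cmp C s' ?e \<in> Inc C \<inter> Hom C (Dom C j') (Dom C j)"
    using Inc_factor[OF I(2,1) Cmp_in[OF s'(1) s(3)]] Cmp_in[OF s'(1) s(3)] by blast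
  \<comment> \<open>The two inclusions now have equal domains and codomains, hence coincide, and the
    common monomorphism cancels from the two factorisations.\<close>
  have d: "Dom C j' = Dom C j"
    using Inc_antisym[OF 1 2] by simp
  then have "j' = j"
    using Inc_unique I cod by simp
  then show ?thesis
    using Inc_mono[OF I(1)] s(3) s'(3) f d Hom_Ob[OF s(3)] unfolding monomorphism_def by auto
qed

lemma epi_part_eq: "normal_factorisation C f q u j \<Longrightarrow> epi_part C f = Cmp C q u"
  unfolding epi_part_def
  by (rule the_equality) (blast, metis normal_factorisation_unique_epi)

end

lemma (in category_with_subobjects) Idn_Inc: "a \<in> Ob C \<Longrightarrow> Idn C a \<in> Inc C"
  using Inc_strict_preorder category.Idn_in[of "inclusion_cat C" a]
  by (auto simp: strict_preorder_def inclusion_cat_def Hom_def)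

lemma (in category) Idn_isomorphism: "a \<in> Ob C \<Longrightarrow> isomorphism C (Idn C a)"
  using Idn_in[of a] Idn_left[of "Idn C a" a a] by (auto simp: isomorphism_def Hom_def)

lemma (in category_with_subobjects) epi_part_Idn:
  assumes a: "a \<in> Ob C"
  shows "epi_part C (Idn C a) = Idn C a"
proof -
  note 1 = Idn_in[OF a] Idn_left[OF Idn_in[OF a]] Idn_Inc[OF a]
  then have "retraction C (Idn C a)"
    unfolding retraction_def retraction_of_def by (intro bexI[of _ "Idn C a"]) (auto simp: Hom_def)
  with 1 have "normal_factorisation C (Idn C a) (Idn C a) (Idn C a) (Idn C a)"
    using Idn_isomorphism[OF a] by (auto simp: normal_factorisation_def Hom_def)
  then show ?thesis
    using epi_part_eq 1 by simp
qed

text \<open>A cone that is the identity at its own vertex is idempotent: multiplying it by itself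
  composes it with the epimorphic part of an identity, which is that identity. Its R-class therefore
  connects the vertex.\<close>

lemma (in normal_category) connected_by_all_classes: "connected_category C (cone_classes C)"
  unfolding connected_category_def
proof (intro conjI ballI)
  show "normal_category C" by unfold_locales
  show "down_set (cone_classes C) (cone_class_le C) (cone_classes C)"
    by (simp add: down_set_def)
  fix c assume c: "c \<in> Ob C"
  then obtain \<mu> where \<mu>: "is_cone C c \<mu>" "\<mu> c = Idn C c"
    using has_cone by blast
  note v = is_cone_vertex[OF \<mu>(1)]
  have \<mu>_ext: "\<mu> \<in> extensional (Ob C)" and hom: "\<And>a. a \<in> Ob C \<Longrightarrow> \<mu> a \<in> Hom C a c"
    using \<mu>(1) by (auto simp: is_cone_def)
  have "Mul (cone_sgrp C) \<mu> \<mu> = \<mu>"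
    using c \<mu>_ext by (intro ext)
      (auto simp: cone_sgrp_def cone_comp_def v \<mu>(2) epi_part_Idn Idn_right[OF hom] extensional_def)
  then have "\<mu> \<in> idempotents (cone_sgrp C)"
    using \<mu>(1) by (auto simp: idempotents_def cone_sgrp_def)
  moreover have "\<mu> \<in> green_R (cone_sgrp C) `` {\<mu>}" "green_R (cone_sgrp C) `` {\<mu>} \<in> cone_classes C"
    using \<mu>(1) by (auto simp: green_R_def R_classes_def quotient_def cone_sgrp_def)
  ultimately show "\<exists>\<dd>\<in>cone_classes C. connected_to C c \<dd>"
    using v unfolding connected_to_def by blast
qed

section \<open>Invariance under isomorphism\<close>

locale cat_iso = category C
  for C :: "('o, 'm, 'x) cat_scheme" +
  fixes C' :: "('p, 'n, 'y) cat_scheme" and \<phi> :: "'o \<Rightarrow> 'p" and \<psi> :: "'m \<Rightarrow> 'n"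
  assumes bij_Ob: "bij_betw \<phi> (Ob C) (Ob C')"
    and bij_Ar: "bij_betw \<psi> (Ar C) (Ar C')"
    and Dom_map: "f \<in> Ar C \<Longrightarrow> Dom C' (\<psi> f) = \<phi> (Dom C f)"
    and Cod_map: "f \<in> Ar C \<Longrightarrow> Cod C' (\<psi> f) = \<phi> (Cod C f)"
    and Idn_map: "a \<in> Ob C \<Longrightarrow> Idn C' (\<phi> a) = \<psi> (Idn C a)"
    and Cmp_map: "f \<in> Ar C \<Longrightarrow> g \<in> Ar C \<Longrightarrow> Cod C f = Dom C g \<Longrightarrow>
      Cmp C' (\<psi> f) (\<psi> g) = \<psi> (Cmp C f g)"
begin

lemma Ob_image: "Ob C' = \<phi> ` Ob C"
  using bij_Ob by (simp add: bij_betw_def)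

lemma Ar_image: "Ar C' = \<psi> ` Ar C"
  using bij_Ar by (simp add: bij_betw_def)

lemma Ob_eq_iff: "a \<in> Ob C \<Longrightarrow> b \<in> Ob C \<Longrightarrow> \<phi> a = \<phi> b \<longleftrightarrow> a = b"
  using bij_Ob by (auto simp: bij_betw_def inj_on_def)

lemma Ar_eq_iff: "f \<in> Ar C \<Longrightarrow> g \<in> Ar C \<Longrightarrow> \<psi> f = \<psi> g \<longleftrightarrow> f = g"
  using bij_Ar by (auto simp: bij_betw_def inj_on_def)

lemma Hom_image: "a \<in> Ob C \<Longrightarrow> b \<in> Ob C \<Longrightarrow> Hom C' (\<phi> a) (\<phi> b) = \<psi> ` Hom C a b"
  by (auto simp: Hom_def Ar_image Dom_map Cod_map Ob_eq_iff Dom_in Cod_in)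

lemma Hom_map_iff:
  "f \<in> Ar C \<Longrightarrow> a \<in> Ob C \<Longrightarrow> b \<in> Ob C \<Longrightarrow> \<psi> f \<in> Hom C' (\<phi> a) (\<phi> b) \<longleftrightarrow> f \<in> Hom C a b"
  by (auto simp: Hom_def Ar_image Dom_map Cod_map Ob_eq_iff Dom_in Cod_in)

lemma Hom_imageE:
  assumes "f' \<in> Hom C' a' b'"
  obtains a b f where "a \<in> Ob C" "b \<in> Ob C" "f \<in> Hom C a b" "a' = \<phi> a" "b' = \<phi> b" "f' = \<psi> f"
  using assms Dom_in Cod_in by (auto simp: Hom_def Ar_image Dom_map Cod_map)

lemma Cmp_map_Hom: "f \<in> Hom C a b \<Longrightarrow> g \<in> Hom C b c \<Longrightarrow> Cmp C' (\<psi> f) (\<psi> g) = \<psi> (Cmp C f g)"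
  by (simp add: Hom_def Cmp_map)

text \<open>The locale assumes the axioms only for \<open>C\<close>. Every arrow of
  \<open>C'\<close> is an image under \<open>\<psi>\<close> and the object map is injective, so each
  law is pulled back to \<open>C\<close> and mapped forward again.\<close>

lemma category_image: "category C'"
proof
  show "Dom C' f \<in> Ob C'" "Cod C' f \<in> Ob C'" if "f \<in> Ar C'" for f
    using that Dom_in Cod_in by (auto simp: Ar_image Ob_image Dom_map Cod_map)
  show "Idn C' a \<in> Hom C' a a" if "a \<in> Ob C'" for a
    using that Idn_in by (auto simp: Ob_image Hom_image Idn_map)
  fix f a b assume f: "f \<in> Hom C' a b"
  then obtain a0 b0 f0 where f0: "a0 \<in> Ob C" "b0 \<in> Ob C" "f0 \<in> Hom C a0 b0"
      "a = \<phi> a0" "b = \<phi> b0" "f = \<psi> f0"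
    by (rule Hom_imageE)
  show "Cmp C' (Idn C' a) f = f" "Cmp C' f (Idn C' b) = f"
    using f0 Idn_in[of a0] Idn_in[of b0] Cmp_map_Hom[of "Idn C a0" a0 a0 f0 b0]
      Cmp_map_Hom[of f0 a0 b0 "Idn C b0" b0] by (auto simp: Idn_map Idn_left Idn_right)
  fix g c assume "g \<in> Hom C' b c"
  then obtain c0 g0 where g0: "c0 \<in> Ob C" "g0 \<in> Hom C b0 c0" "c = \<phi> c0" "g = \<psi> g0"
    using f0 by (elim Hom_imageE) (auto simp: Ob_eq_iff)
  have fg: "Cmp C f0 g0 \<in> Hom C a0 c0"
    using Cmp_in f0 g0 by blast
  then show "Cmp C' f g \<in> Hom C' a c"
    using f0 g0 Cmp_map_Hom by (auto simp: Hom_image)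
  fix h d assume "h \<in> Hom C' c d"
  then obtain d0 h0 where h0: "d0 \<in> Ob C" "h0 \<in> Hom C c0 d0" "d = \<phi> d0" "h = \<psi> h0"
    using g0 by (elim Hom_imageE) (auto simp: Ob_eq_iff)
  have "Cmp C g0 h0 \<in> Hom C b0 d0"
    using Cmp_in g0 h0 by blast
  then show "Cmp C' (Cmp C' f g) h = Cmp C' f (Cmp C' g h)"
    using f0 g0 h0 fg Cmp_map_Hom Cmp_assoc by metis
qed

lemma monomorphism_map:
  assumes f: "f \<in> Ar C"
  shows "monomorphism C' (\<psi> f) \<longleftrightarrow> monomorphism C f"
proof -
  have "Cmp C' (\<psi> g) (\<psi> f) = Cmp C' (\<psi> h) (\<psi> f) \<longleftrightarrow> Cmp C g f = Cmp C h f" "\<psi> g = \<psi> h \<longleftrightarrow> g = h"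
    if "g \<in> Hom C a (Dom C f)" "h \<in> Hom C a (Dom C f)" for a g h
    using that[THEN Cmp_map_Hom, OF Hom_selfI[OF f]] that[THEN Cmp_in, OF Hom_selfI[OF f]] that
    by (simp_all add: Ar_eq_iff HomD)
  then show ?thesis
    using f unfolding monomorphism_def by (simp add: Ob_image Ar_image Dom_map Hom_image Dom_in)
qed

lemma isomorphism_map:
  assumes f: "f \<in> Ar C"
  shows "isomorphism C' (\<psi> f) \<longleftrightarrow> isomorphism C f"
proof -
  have "Cmp C' (\<psi> f) (\<psi> g) = Idn C' (\<phi> (Dom C f)) \<longleftrightarrow> Cmp C f g = Idn C (Dom C f)"
    "Cmp C' (\<psi> g) (\<psi> f) = Idn C' (\<phi> (Cod C f)) \<longleftrightarrow> Cmp C g f = Idn C (Cod C f)"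
    if g: "g \<in> Hom C (Cod C f) (Dom C f)" for g
    using Cmp_map_Hom[OF Hom_selfI[OF f] g] Cmp_map_Hom[OF g Hom_selfI[OF f]]
      Cmp_in[OF Hom_selfI[OF f] g, THEN HomD] Cmp_in[OF g Hom_selfI[OF f], THEN HomD]
      Idn_in[OF Dom_in[OF f], THEN HomD] Idn_in[OF Cod_in[OF f], THEN HomD] Dom_in[OF f] Cod_in[OF f]
    by (simp_all add: Idn_map Ar_eq_iff)
  then show ?thesis
    using f by (auto simp: isomorphism_def Ar_image Dom_map Cod_map Hom_image Dom_in Cod_in)
qed

lemma strict_preorder_image:
  assumes "strict_preorder C"
  shows "strict_preorder C'"
  unfolding strict_preorder_def
proof (intro conjI ballI impI)
  show "category C'" by (rule category_image)
  show "f = g" if "a \<in> Ob C'" "b \<in> Ob C'" "f \<in> Hom C' a b" "g \<in> Hom C' a b" for a b f g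
    using that assms unfolding strict_preorder_def
    by (auto simp: Ob_image Hom_image intro!: arg_cong[where f = \<psi>])
  show "f = Idn C' (Dom C' f)" if f: "f \<in> Ar C'" "isomorphism C' f" for f
  proof -
    obtain f0 where "f0 \<in> Ar C" "f = \<psi> f0" using f by (auto simp: Ar_image)
    then show ?thesis
      using f assms Dom_in by (auto simp: strict_preorder_def isomorphism_map Dom_map Idn_map)
  qed
qed

end

text \<open>The invariant \<open>k\<close> classifies principal right ideals: by antisymmetry two of
  them coincide exactly when their values of \<open>k\<close> do. R-classes are therefore the fibres
  of \<open>k\<close>, and inclusion of ideals is the order of the values.\<close>

lemma order_iso_R_classes:
  assumes onto: "k ` Car S = E"
    and le_iff: "\<And>a b. a \<in> Car S \<Longrightarrow> b \<in> Car S \<Longrightarrow>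
      principal_right S a \<subseteq> principal_right S b \<longleftrightarrow> le (k a) (k b)"
    and antisym: "\<And>x y. x \<in> E \<Longrightarrow> y \<in> E \<Longrightarrow> le x y \<Longrightarrow> le y x \<Longrightarrow> x = y"
  shows "order_iso E le (R_classes S) (R_le S) (\<lambda>e. {a \<in> Car S. k a = e})"
proof -
  let ?\<theta> = "\<lambda>e. {a \<in> Car S. k a = e}"
  have eq_iff: "principal_right S a = principal_right S b \<longleftrightarrow> k a = k b"
    if "a \<in> Car S" "b \<in> Car S" for a b
  proof
    show "principal_right S a = principal_right S b \<Longrightarrow> k a = k b"
      using that onto le_iff antisym by (metis imageI order_refl)
    show "k a = k b \<Longrightarrow> principal_right S a = principal_right S b"
      using that le_iff by (metis order_refl subset_antisym)
  qed
  have cls: "green_R S `` {a} = ?\<theta> (k a)" if "a \<in> Car S" for a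
    using that by (simp add: green_R_def Image_def eq_iff eq_commute[of "k a"] cong: conj_cong)
  have "inj_on ?\<theta> E"
  proof (rule inj_onI)
    fix x y assume "x \<in> E" "y \<in> E" and eq: "?\<theta> x = ?\<theta> y"
    then obtain a where "a \<in> Car S" "k a = x"
      using onto by blast
    then have "a \<in> ?\<theta> y"
      using eq by blast
    then show "x = y"
      using \<open>k a = x\<close> by simp
  qed
  moreover have "?\<theta> ` E = R_classes S"
    using cls by (auto simp: R_classes_def quotient_def onto[symmetric] image_iff)
  moreover have "le x y \<longleftrightarrow> R_le S (?\<theta> x) (?\<theta> y)" if "x \<in> E" "y \<in> E" for x y
    using that le_iff onto unfolding R_le_def by blast
  ultimately show ?thesis
    by (simp add: order_iso_def bij_betw_def)
qed

lemma R_classes_subset: "X \<in> R_classes S \<Longrightarrow> X \<subseteq> Car S"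
  by (auto simp: R_classes_def quotient_def green_R_def)

section \<open>Semigroup isomorphisms and R-classes\<close>

locale sgrp_iso =
  fixes S :: "'a sgrp" and S' :: "'b sgrp" and h :: "'a \<Rightarrow> 'b"
  assumes Mul_closed: "a \<in> Car S \<Longrightarrow> b \<in> Car S \<Longrightarrow> Mul S a b \<in> Car S"
    and bij_Car: "bij_betw h (Car S) (Car S')"
    and Mul_map: "a \<in> Car S \<Longrightarrow> b \<in> Car S \<Longrightarrow> Mul S' (h a) (h b) = h (Mul S a b)"
begin

lemma Car_image: "Car S' = h ` Car S"
  using bij_Car by (simp add: bij_betw_def)

lemma inj_Car: "inj_on h (Car S)"
  using bij_Car by (simp add: bij_betw_def)

lemma principal_right_subset: "a \<in> Car S \<Longrightarrow> principal_right S a \<subseteq> Car S"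
  by (auto simp: principal_right_def Mul_closed)

lemma principal_right_map: "a \<in> Car S \<Longrightarrow> principal_right S' (h a) = h ` principal_right S a"
  by (simp add: principal_right_def Car_image setcompr_eq_image image_image Mul_map cong: image_cong_simp)

lemma principal_right_le_iff:
  "a \<in> Car S \<Longrightarrow> b \<in> Car S \<Longrightarrow>
    principal_right S' (h a) \<subseteq> principal_right S' (h b) \<longleftrightarrow> principal_right S a \<subseteq> principal_right S b"
  using principal_right_subset[of a] principal_right_subset[of b] inj_on_image_mem_iff[OF inj_Car]
  unfolding principal_right_map by blast

lemma principal_right_eq_iff:
  "a \<in> Car S \<Longrightarrow> b \<in> Car S \<Longrightarrow>
    principal_right S' (h a) = principal_right S' (h b) \<longleftrightarrow> principal_right S a = principal_right S b"
  by (simp add: set_eq_subset principal_right_le_iff)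

lemma R_class_map: "a \<in> Car S \<Longrightarrow> green_R S' `` {h a} = h ` (green_R S `` {a})"
proof -
  assume a: "a \<in> Car S"
  then have "green_R S' `` {h a} = {b' \<in> h ` Car S. principal_right S' (h a) = principal_right S' b'}"
    by (simp add: green_R_def Image_def Car_image)
  also have "\<dots> = h ` {b \<in> Car S. principal_right S' (h a) = principal_right S' (h b)}"
    by blast
  also have "\<dots> = h ` (green_R S `` {a})"
    using a by (simp add: green_R_def Image_def principal_right_eq_iff cong: conj_cong)
  finally show ?thesis .
qed

lemma R_classes_image: "R_classes S' = (`) h ` R_classes S"
  by (auto simp: R_classes_def quotient_def Car_image R_class_map)

lemma bij_R_classes: "bij_betw ((`) h) (R_classes S) (R_classes S')"
  unfolding bij_betw_def R_classes_image
  by (intro conjI inj_onI refl) (metis inj_on_image_eq_iff[OF inj_Car] R_classes_subset)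

lemma R_le_map:
  assumes "X \<subseteq> Car S" "Y \<subseteq> Car S"
  shows "R_le S' (h ` X) (h ` Y) \<longleftrightarrow> R_le S X Y"
proof -
  have "principal_right S' (h a) \<subseteq> principal_right S' (h b) \<longleftrightarrow> principal_right S a \<subseteq> principal_right S b"
    if "a \<in> X" "b \<in> Y" for a b
    using that assms by (intro principal_right_le_iff) auto
  then show ?thesis
    by (simp add: R_le_def)
qed

lemma idempotents_map: "a \<in> Car S \<Longrightarrow> h a \<in> idempotents S' \<longleftrightarrow> a \<in> idempotents S"
  using inj_on_eq_iff[OF inj_Car] by (auto simp: idempotents_def Car_image Mul_map Mul_closed)

end

section \<open>Transport of subobjects, cones and normality\<close>

locale subobj_cat_iso = normal_category C + cat_iso C C' \<phi> \<psi>
  for C :: "('o, 'm, 'x) subobj_cat_scheme" and C' :: "('p, 'n, 'y) subobj_cat_scheme"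
    and \<phi> :: "'o \<Rightarrow> 'p" and \<psi> :: "'m \<Rightarrow> 'n" +
  assumes Inc_image: "Inc C' = \<psi> ` Inc C"
begin

text \<open>The two maps restrict to the subcategories of inclusions, so that
  \<open>strict_preorder_image\<close> can be applied to these instead of to the whole
  categories.\<close>

lemma inclusion_cat_iso: "cat_iso (inclusion_cat C) (inclusion_cat C') \<phi> \<psi>"
proof -
  interpret I: category "inclusion_cat C"
    using Inc_strict_preorder by (simp add: strict_preorder_def)
  have "bij_betw \<psi> (Inc C) (Inc C')"
    using bij_betw_subset[OF bij_Ar Inc_subset] by (simp add: Inc_image)
  then show ?thesis
    using bij_Ob Inc_subset
    by unfold_locales (auto simp: inclusion_cat_def Dom_map Cod_map Idn_map intro!: Cmp_map)
qed

lemma Inc_Hom_image: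
  "a \<in> Ob C \<Longrightarrow> b \<in> Ob C \<Longrightarrow> Inc C' \<inter> Hom C' (\<phi> a) (\<phi> b) = \<psi> ` (Inc C \<inter> Hom C a b)"
  using Inc_subset Hom_map_iff by (auto simp: Inc_image)

lemma subobj_le_map: "a \<in> Ob C \<Longrightarrow> b \<in> Ob C \<Longrightarrow> subobj_le C' (\<phi> a) (\<phi> b) \<longleftrightarrow> subobj_le C a b"
  by (simp add: subobj_le_def Inc_Hom_image)

lemma retraction_of_map:
  assumes "j \<in> Ar C" "retraction_of C j q"
  shows "retraction_of C' (\<psi> j) (\<psi> q)"
proof -
  have "q \<in> Hom C (Cod C j) (Dom C j)" "Cmp C j q = Idn C (Dom C j)"
    using assms by (simp_all add: retraction_of_def)
  moreover have "Cmp C' (\<psi> j) (\<psi> q) = \<psi> (Cmp C j q)"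
    using calculation(1) assms(1) by (simp add: Hom_def Cmp_map)
  ultimately show ?thesis
    using assms(1) by (simp add: retraction_of_def Dom_map Cod_map Hom_image Dom_in Cod_in Idn_map)
qed

lemma normal_factorisation_map:
  assumes "normal_factorisation C f q u j"
  shows "normal_factorisation C' (\<psi> f) (\<psi> q) (\<psi> u) (\<psi> j)"
proof -
  obtain i where i: "i \<in> Inc C" "retraction_of C i q"
    using assms by (auto simp: normal_factorisation_def retraction_def)
  then have "\<psi> i \<in> Inc C'" "retraction_of C' (\<psi> i) (\<psi> q)"
    using Inc_subset retraction_of_map by (auto simp: Inc_image)
  then have "retraction C' (\<psi> q)"
    by (auto simp: retraction_def)
  moreover have ar: "q \<in> Ar C" "u \<in> Ar C" "j \<in> Ar C"
    using assms i Inc_subset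
    by (auto simp: normal_factorisation_def retraction_of_def Hom_def isomorphism_def)
  moreover have qu: "Cmp C q u \<in> Hom C (Dom C q) (Cod C u)"
    using assms Cmp_in[OF Hom_selfI[OF ar(1)], of u "Cod C u"] Hom_selfI[OF ar(2)]
    by (simp add: normal_factorisation_def)
  moreover have "f \<in> Ar C"
    using assms ar Cmp_in[OF qu, of j "Cod C j"] by (auto simp: normal_factorisation_def Hom_def)
  moreover have "Cmp C' (Cmp C' (\<psi> q) (\<psi> u)) (\<psi> j) = \<psi> (Cmp C (Cmp C q u) j)"
    using assms ar qu by (simp add: normal_factorisation_def Cmp_map Hom_def)
  ultimately show ?thesis
    using assms by (auto simp: normal_factorisation_def isomorphism_map Inc_image Dom_map Cod_map)
qed

text \<open>The value at \<open>\<phi> c\<close> is meant to be \<open>\<psi> (\<gamma> c)\<close>;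
  the inverse of \<open>\<phi>\<close> and the restriction to \<open>Ob C'\<close> turn this into an
  extensional map, as cones must be.\<close>

definition cone_map :: "('o \<Rightarrow> 'm) \<Rightarrow> 'p \<Rightarrow> 'n" where
  "cone_map \<gamma> = (\<lambda>c'\<in>Ob C'. \<psi> (\<gamma> (inv_into (Ob C) \<phi> c')))"

lemma cone_map_apply [simp]: "c \<in> Ob C \<Longrightarrow> cone_map \<gamma> (\<phi> c) = \<psi> (\<gamma> c)"
  using bij_Ob by (auto simp: cone_map_def Ob_image bij_betw_def)

lemma cone_map_eqI:
  assumes "\<gamma>' \<in> extensional (Ob C')" "\<And>c. c \<in> Ob C \<Longrightarrow> \<gamma>' (\<phi> c) = \<psi> (\<gamma> c)"
  shows "\<gamma>' = cone_map \<gamma>"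
proof (rule extensionalityI[OF assms(1)])
  show "cone_map \<gamma> \<in> extensional (Ob C')" by (simp add: cone_map_def)
  show "\<gamma>' c' = cone_map \<gamma> c'" if "c' \<in> Ob C'" for c'
    using that assms(2) by (auto simp: Ob_image)
qed

lemma inj_cone_map: "inj_on cone_map (Ob C \<rightarrow>\<^sub>E Ar C)"
proof (rule inj_onI)
  fix \<gamma> \<delta> assume 1: "\<gamma> \<in> Ob C \<rightarrow>\<^sub>E Ar C" "\<delta> \<in> Ob C \<rightarrow>\<^sub>E Ar C" and 2: "cone_map \<gamma> = cone_map \<delta>"
  show "\<gamma> = \<delta>"
    using 1 by (rule PiE_ext) (use 1 2 cone_map_apply Ar_eq_iff in \<open>metis PiE_mem\<close>)
qed

text \<open>Since \<open>incl\<close> is a definite description, both sides need uniqueness of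
  inclusions. For \<open>C'\<close> it comes from the last hypothesis, which
  \<open>category_with_subobjects_image\<close> supplies later.\<close>

lemma incl_map:
  assumes "a \<in> Ob C" "b \<in> Ob C" "subobj_le C a b" "category_with_subobjects C'"
  shows "incl C' (\<phi> a) (\<phi> b) = \<psi> (incl C a b)" "incl C a b \<in> Hom C a b"
proof -
  obtain j where j: "j \<in> Inc C \<inter> Hom C a b"
    using assms by (auto simp: subobj_le_def)
  then have "\<psi> j \<in> Inc C' \<inter> Hom C' (\<phi> a) (\<phi> b)"
    using assms by (simp add: Inc_Hom_image)
  then show "incl C' (\<phi> a) (\<phi> b) = \<psi> (incl C a b)" "incl C a b \<in> Hom C a b"
    using category_with_subobjects.incl_eq[OF assms(4)] incl_eq[OF j] j by auto
qed

lemma category_with_subobjects_image: "category_with_subobjects C'"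
proof -
  interpret C': category C' by (rule category_image)
  show ?thesis
  proof
    show "Inc C' \<subseteq> Ar C'"
      using Inc_subset by (auto simp: Inc_image Ar_image)
    show "strict_preorder (inclusion_cat C')"
      using cat_iso.strict_preorder_image[OF inclusion_cat_iso Inc_strict_preorder] .
    show "monomorphism C' f" if "f \<in> Inc C'" for f
      using that Inc_mono Inc_subset monomorphism_map by (auto simp: Inc_image)
    fix f g h assume "f \<in> Inc C'" "g \<in> Inc C'" and h: "h \<in> Hom C' (Dom C' f) (Dom C' g)"
      and f: "f = Cmp C' h g"
    then obtain f0 g0 where f0: "f0 \<in> Inc C" "f = \<psi> f0" and g0: "g0 \<in> Inc C" "g = \<psi> g0"
      by (auto simp: Inc_image)
    have ar: "f0 \<in> Ar C" "g0 \<in> Ar C"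
      using f0 g0 Inc_subset by auto
    then obtain h0 where h0: "h0 \<in> Hom C (Dom C f0) (Dom C g0)" "h = \<psi> h0"
      using h f0 g0 by (auto simp: Dom_map Hom_image Dom_in)
    have "\<psi> f0 = \<psi> (Cmp C h0 g0)"
      using f f0 g0 h0 ar Cmp_map_Hom[OF h0(1) Hom_selfI[OF ar(2)]] by simp
    then have "f0 = Cmp C h0 g0"
      using ar Cmp_in[OF h0(1) Hom_selfI[OF ar(2)]] by (simp add: Ar_eq_iff Hom_def)
    then show "h \<in> Inc C'"
      using Inc_factor[OF f0(1) g0(1) h0(1)] h0(2) by (simp add: Inc_image)
  qed
qed

text \<open>The equivalence covers arbitrary families of arrows, so that it also shows that the
  family pulled back from a cone of \<open>C'\<close> is a cone, as \<open>is_cone_imageE\<close>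
  requires.\<close>

lemma is_cone_map_iff:
  assumes z: "z \<in> Ob C" and \<gamma>: "\<gamma> \<in> Ob C \<rightarrow>\<^sub>E Ar C"
  shows "is_cone C' (\<phi> z) (cone_map \<gamma>) \<longleftrightarrow> is_cone C z \<gamma>"
proof -
  have "cone_map \<gamma> (\<phi> c) \<in> Hom C' (\<phi> c) (\<phi> z) \<longleftrightarrow> \<gamma> c \<in> Hom C c z" if "c \<in> Ob C" for c
    using that z PiE_mem[OF \<gamma> that] by (simp add: Hom_map_iff)
  moreover have "Cmp C' (incl C' (\<phi> a) (\<phi> b)) (cone_map \<gamma> (\<phi> b)) = cone_map \<gamma> (\<phi> a) \<longleftrightarrow>
      Cmp C (incl C a b) (\<gamma> b) = \<gamma> a"
    if "a \<in> Ob C" "b \<in> Ob C" "subobj_le C a b" "\<gamma> b \<in> Hom C b z" for a b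
    using that incl_map[OF that(1-3) category_with_subobjects_image] PiE_mem[OF \<gamma> that(1)]
      Cmp_in[of "incl C a b" a b "\<gamma> b" z] Cmp_map_Hom[of "incl C a b" a b "\<gamma> b" z]
    by (simp add: Ar_eq_iff HomD)
  moreover have "isomorphism C' (cone_map \<gamma> (\<phi> c)) \<longleftrightarrow> isomorphism C (\<gamma> c)" if "c \<in> Ob C" for c
    using that PiE_mem[OF \<gamma> that] by (simp add: isomorphism_map)
  moreover have "cone_map \<gamma> \<in> extensional (Ob C')" "\<gamma> \<in> extensional (Ob C)"
    using \<gamma> by (auto simp: cone_map_def PiE_def)
  \<comment> \<open>\<open>cone_map_apply\<close> is switched off so that the terms keep the shape
    of the facts above; \<open>conj_cong\<close> makes the typing of the components available in the
    compatibility condition.\<close>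
  ultimately show ?thesis
    using z by (simp add: is_cone_def Ob_image subobj_le_map del: cone_map_apply cong: conj_cong)
qed

lemma is_cone_PiE: "is_cone C z \<gamma> \<Longrightarrow> \<gamma> \<in> Ob C \<rightarrow>\<^sub>E Ar C"
  by (auto simp: is_cone_def Hom_def PiE_def)

lemma is_cone_map: "is_cone C z \<gamma> \<Longrightarrow> is_cone C' (\<phi> z) (cone_map \<gamma>)"
  using is_cone_map_iff[OF _ is_cone_PiE, of z z \<gamma>] by (simp add: is_cone_def[of C z])

lemma is_cone_imageE:
  assumes "is_cone C' z' \<gamma>'"
  obtains z \<gamma> where "is_cone C z \<gamma>" "z' = \<phi> z" "\<gamma>' = cone_map \<gamma>"
proof -
  obtain z where z: "z \<in> Ob C" "z' = \<phi> z"
    using assms by (auto simp: is_cone_def Ob_image)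
  define \<gamma> where "\<gamma> = (\<lambda>c\<in>Ob C. inv_into (Ar C) \<psi> (\<gamma>' (\<phi> c)))"
  have ar: "\<gamma>' (\<phi> c) \<in> \<psi> ` Ar C" if "c \<in> Ob C" for c
    using assms that by (auto simp: is_cone_def Ob_image Hom_def Ar_image)
  then have P: "\<gamma> \<in> Ob C \<rightarrow>\<^sub>E Ar C"
    by (auto simp: \<gamma>_def intro: inv_into_into)
  have "\<gamma>' = cone_map \<gamma>"
    using assms ar by (intro cone_map_eqI) (auto simp: is_cone_def \<gamma>_def f_inv_into_f)
  then show ?thesis
    using that z assms is_cone_map_iff[OF z(1) P] by simp
qed

lemma normal_category_image: "normal_category C'"
proof -
  interpret C': category_with_subobjects C' by (rule category_with_subobjects_image)
  show ?thesis
  proof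
    show "\<exists>q. retraction_of C' j q" if "j \<in> Inc C'" for j
      using that Inc_splits Inc_subset retraction_of_map unfolding Inc_image by blast
    show "\<exists>q u j. normal_factorisation C' f q u j" if "f \<in> Ar C'" for f
      using that has_normal_factorisation normal_factorisation_map unfolding Ar_image by blast
    fix c' assume "c' \<in> Ob C'"
    then obtain c where c: "c \<in> Ob C" "c' = \<phi> c"
      by (auto simp: Ob_image)
    then obtain \<mu> where "is_cone C c \<mu>" "\<mu> c = Idn C c"
      using has_cone by blast
    then have "is_cone C' c' (cone_map \<mu>)" "cone_map \<mu> c' = Idn C' c'"
      using c is_cone_map by (auto simp: Idn_map)
    then show "\<exists>\<mu>. is_cone C' c' \<mu> \<and> \<mu> c' = Idn C' c'"
      by blast
  qed
qed

lemma bounded_above_image: "bounded_above C \<Longrightarrow> bounded_above C'"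
  by (auto simp: bounded_above_def Ob_image subobj_le_map)

text \<open>A normal factorisation in \<open>C\<close> is carried to one in \<open>C'\<close>. As
  epimorphic parts do not depend on the factorisation, these two may be used to compute both
  sides.\<close>

lemma epi_part_map:
  assumes "f \<in> Ar C"
  shows "epi_part C' (\<psi> f) = \<psi> (epi_part C f)" "epi_part C f \<in> Ar C" "Dom C (epi_part C f) = Dom C f"
proof -
  interpret C': normal_category C' by (rule normal_category_image)
  obtain q u j where n: "normal_factorisation C f q u j"
    using has_normal_factorisation[OF assms] by blast
  then have "q \<in> Ar C" "u \<in> Ar C" "Cod C q = Dom C u" "Dom C q = Dom C f"
    by (auto simp: normal_factorisation_def retraction_def retraction_of_def isomorphism_def Hom_def)
  then show "epi_part C' (\<psi> f) = \<psi> (epi_part C f)" "epi_part C f \<in> Ar C" "Dom C (epi_part C f) = Dom C f"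
    using epi_part_eq[OF n] C'.epi_part_eq[OF normal_factorisation_map[OF n]]
      normal_factorisation_section[OF n] by (auto simp: Cmp_map Hom_def)
qed

text \<open>The product of cones is built from the vertex, the epimorphic part and composition, all
  of which the isomorphism preserves. Closure of the cones of \<open>C\<close> under the product is
  a hypothesis, verified for \<open>\<V>\<close> in \<open>cones_closed\<close>.\<close>

lemma cone_sgrp_iso:
  assumes "\<And>\<gamma> \<delta>. \<gamma> \<in> Car (cone_sgrp C) \<Longrightarrow> \<delta> \<in> Car (cone_sgrp C) \<Longrightarrow>
    Mul (cone_sgrp C) \<gamma> \<delta> \<in> Car (cone_sgrp C)"
  shows "sgrp_iso (cone_sgrp C) (cone_sgrp C') cone_map"
proof
  show "Mul (cone_sgrp C) \<gamma> \<delta> \<in> Car (cone_sgrp C)"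
    if "\<gamma> \<in> Car (cone_sgrp C)" "\<delta> \<in> Car (cone_sgrp C)" for \<gamma> \<delta>
    using that by (rule assms)
  have "inj_on cone_map (Car (cone_sgrp C))"
    by (rule inj_on_subset[OF inj_cone_map]) (auto simp: cone_sgrp_def dest: is_cone_PiE)
  moreover have "cone_map ` Car (cone_sgrp C) = Car (cone_sgrp C')"
    using is_cone_map by (auto simp: cone_sgrp_def elim!: is_cone_imageE)
  ultimately show "bij_betw cone_map (Car (cone_sgrp C)) (Car (cone_sgrp C'))"
    by (simp add: bij_betw_def)
  fix \<gamma> \<delta> assume "\<gamma> \<in> Car (cone_sgrp C)" "\<delta> \<in> Car (cone_sgrp C)"
  then obtain y z where \<gamma>: "is_cone C y \<gamma>" and \<delta>: "is_cone C z \<delta>"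
    by (auto simp: cone_sgrp_def)
  have y: "y \<in> Ob C" and hom: "\<And>c. c \<in> Ob C \<Longrightarrow> \<gamma> c \<in> Hom C c y" and "\<delta> y \<in> Hom C y z"
    using \<gamma> \<delta> by (auto simp: is_cone_def)
  then have d: "\<delta> y \<in> Ar C" "Dom C (\<delta> y) = y"
    by (auto simp: Hom_def)
  show "Mul (cone_sgrp C') (cone_map \<gamma>) (cone_map \<delta>) = cone_map (Mul (cone_sgrp C) \<gamma> \<delta>)"
    by (rule cone_map_eqI)
      (use hom y d in \<open>auto simp: cone_sgrp_def cone_comp_def is_cone_vertex[OF \<gamma>]
        is_cone_vertex[OF is_cone_map[OF \<gamma>]] epi_part_map Ob_image Hom_def Cmp_map\<close>)
qed

end

text \<open>The added assumptions are what the transport of connections uses: closure of the cones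
  under the product, and at most one idempotent with a given vertex in each R-class, so that
  \<open>idem_cone\<close> is well defined. For \<open>\<V>\<close> both are checked on linear
  transformations.\<close>

locale connected_cat_iso = subobj_cat_iso C C' \<phi> \<psi>
  for C :: "('o, 'm, 'x) subobj_cat_scheme" and C' :: "('p, 'n, 'y) subobj_cat_scheme"
    and \<phi> :: "'o \<Rightarrow> 'p" and \<psi> :: "'m \<Rightarrow> 'n" +
  assumes cone_closed: "\<And>\<gamma> \<delta>. \<gamma> \<in> Car (cone_sgrp C) \<Longrightarrow> \<delta> \<in> Car (cone_sgrp C) \<Longrightarrow>
      Mul (cone_sgrp C) \<gamma> \<delta> \<in> Car (cone_sgrp C)"
    and idem_cone_unique: "\<And>\<gamma> \<delta>. \<gamma> \<in> idempotents (cone_sgrp C) \<Longrightarrow> \<delta> \<in> idempotents (cone_sgrp C) \<Longrightarrow>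
      vertex C \<gamma> = vertex C \<delta> \<Longrightarrow>
      principal_right (cone_sgrp C) \<gamma> = principal_right (cone_sgrp C) \<delta> \<Longrightarrow> \<gamma> = \<delta>"
begin

text \<open>\<open>cone_map\<close> preserves and reflects idempotency and moves vertices by
  \<open>\<phi>\<close>, so the candidates in \<open>\<dd>\<close> and in its image correspond.
  Members of one R-class generate the same right ideal, so the candidate is unique, which determines
  both definite descriptions.\<close>

lemma cone_class_transport:
  assumes c: "c \<in> Ob C" and d: "\<dd> \<in> cone_classes C"
  shows "connected_to C' (\<phi> c) (cone_map ` \<dd>) \<longleftrightarrow> connected_to C c \<dd>"
    and "connected_to C c \<dd> \<Longrightarrow> idem_cone C' (\<phi> c) (cone_map ` \<dd>) = cone_map (idem_cone C c \<dd>)"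
    and "connected_to C c \<dd> \<Longrightarrow> is_cone C c (idem_cone C c \<dd>)"
proof -
  let ?S = "cone_sgrp C" and ?S' = "cone_sgrp C'"
  interpret sgrp_iso ?S ?S' cone_map
    using cone_closed by (rule cone_sgrp_iso)
  define P where "P \<gamma> \<longleftrightarrow> \<gamma> \<in> idempotents ?S \<and> vertex C \<gamma> = c" for \<gamma>
  define P' where "P' \<gamma> \<longleftrightarrow> \<gamma> \<in> idempotents ?S' \<and> vertex C' \<gamma> = \<phi> c" for \<gamma>
  have P'_iff: "P' (cone_map \<gamma>) \<longleftrightarrow> P \<gamma>" if "\<gamma> \<in> \<dd>" for \<gamma>
  proof -
    have \<gamma>: "\<gamma> \<in> Car ?S"
      using R_classes_subset[OF d] that by blast
    then obtain z where z: "is_cone C z \<gamma>" "z \<in> Ob C"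
      by (auto simp: cone_sgrp_def is_cone_def)
    show ?thesis
      using c z idempotents_map[OF \<gamma>] is_cone_vertex[OF z(1)] is_cone_vertex[OF is_cone_map[OF z(1)]]
      by (simp add: P_def P'_def Ob_eq_iff)
  qed
  then show "connected_to C' (\<phi> c) (cone_map ` \<dd>) \<longleftrightarrow> connected_to C c \<dd>"
    unfolding connected_to_def P_def P'_def by blast
  assume "connected_to C c \<dd>"
  then obtain \<gamma> where \<gamma>: "\<gamma> \<in> \<dd>" "P \<gamma>"
    by (auto simp: connected_to_def P_def)
  have uniq: "\<delta> = \<gamma>" if "\<delta> \<in> \<dd>" "P \<delta>" for \<delta>
  proof -
    have "principal_right ?S \<delta> = principal_right ?S \<gamma>"
      using d \<gamma>(1) that(1) by (auto simp: R_classes_def quotient_def green_R_def)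
    then show ?thesis
      using idem_cone_unique[of \<delta> \<gamma>] that(2) \<gamma>(2) by (simp add: P_def)
  qed
  have 1: "idem_cone C c \<dd> = \<gamma>"
    unfolding idem_cone_def P_def[symmetric] by (rule the_equality) (use \<gamma> uniq in blast)+
  have "\<gamma>' = cone_map \<gamma>" if "\<gamma>' \<in> cone_map ` \<dd>" "P' \<gamma>'" for \<gamma>'
    using that P'_iff uniq by auto
  then have "idem_cone C' (\<phi> c) (cone_map ` \<dd>) = cone_map \<gamma>"
    unfolding idem_cone_def P'_def[symmetric]
    by (intro the_equality) (use \<gamma> P'_iff[OF \<gamma>(1)] in blast)+
  then show "idem_cone C' (\<phi> c) (cone_map ` \<dd>) = cone_map (idem_cone C c \<dd>)"
    using 1 by simp
  obtain z where z: "is_cone C z \<gamma>"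
    using R_classes_subset[OF d] \<gamma>(1) by (auto simp: cone_sgrp_def)
  then show "is_cone C c (idem_cone C c \<dd>)"
    using \<gamma>(2) is_cone_vertex[OF z] unfolding 1 P_def by blast
qed

theorem CC_isomorphic_image:
  shows "CC_isomorphic C' (cone_classes C') C (cone_classes C)"
proof -
  let ?R = "cone_classes C" and ?R' = "cone_classes C'"
  interpret sgrp_iso "cone_sgrp C" "cone_sgrp C'" cone_map
    using cone_closed by (rule cone_sgrp_iso)
  interpret C': normal_category C' by (rule normal_category_image)
  define \<phi>' where "\<phi>' = inv_into (Ob C) \<phi>"
  define \<psi>' where "\<psi>' = inv_into (Ar C) \<psi>"
  define G' where "G' = inv_into ?R ((`) cone_map)"
  have inv [simp]: "\<And>c. c \<in> Ob C \<Longrightarrow> \<phi>' (\<phi> c) = c" "\<And>f. f \<in> Ar C \<Longrightarrow> \<psi>' (\<psi> f) = f"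
    "\<And>d. d \<in> ?R \<Longrightarrow> G' (cone_map ` d) = d"
    using bij_Ob bij_Ar bij_R_classes inv_into_f_f[of "(`) cone_map" ?R]
    by (auto simp: \<phi>'_def \<psi>'_def G'_def bij_betw_def)
  have mem: "\<And>f. f \<in> Ar C \<Longrightarrow> Dom C f \<in> Ob C \<and> Cod C f \<in> Ob C" "\<And>c. c \<in> Ob C \<Longrightarrow> Idn C c \<in> Ar C"
    "\<And>f g. f \<in> Ar C \<Longrightarrow> g \<in> Ar C \<Longrightarrow> Cod C f = Dom C g \<Longrightarrow> Cmp C f g \<in> Ar C"
    using Dom_in Cod_in Idn_in Cmp_in by (fastforce simp: Hom_def)+
  \<comment> \<open>The restrictions make all component maps extensional, so that the composites
    become literally equal to \<open>CC_id\<close>.\<close>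
  define F where "F = \<lparr>on_Ob = restrict \<phi> (Ob C), on_Ar = restrict \<psi> (Ar C)\<rparr>"
  define F' where "F' = \<lparr>on_Ob = restrict \<phi>' (Ob C'), on_Ar = restrict \<psi>' (Ar C')\<rparr>"
  have F: "is_fnctr C C' F"
    using mem by (auto simp: is_fnctr_def F_def Ob_image Ar_image Idn_map Cmp_map Hom_map_iff Hom_selfI)
  have F': "is_fnctr C' C F'"
    using mem by (auto simp: is_fnctr_def F'_def Ob_image Ar_image Idn_map Cmp_map Dom_map Cod_map
        Ob_eq_iff Hom_selfI)
  have "on_Ar F' (\<psi> f) = f" "on_Ar F f = \<psi> f" if "f \<in> Ar C" for f
    using that by (simp_all add: F_def F'_def Ar_image)
  then have inc: "on_Ar F ` Inc C \<subseteq> Inc C'" "on_Ar F' ` Inc C' \<subseteq> Inc C"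
    using Inc_subset by (auto simp: Inc_image subset_iff)
  have R: "?R' = (`) cone_map ` ?R"
    by (rule R_classes_image)
  have mono: "cone_class_le C' (cone_map ` X) (cone_map ` Y) \<longleftrightarrow> cone_class_le C X Y"
    if "X \<in> ?R" "Y \<in> ?R" for X Y
    using that R_classes_subset R_le_map by blast
  \<comment> \<open>The components of idempotent cones must be arrows of \<open>C\<close> for the
    restricted \<open>\<psi>\<close> to apply to them and for \<open>\<psi>'\<close> to undo
    \<open>\<psi>\<close>.\<close>
  have val: "idem_cone C c d x \<in> Ar C" if "c \<in> Ob C" "d \<in> ?R" "connected_to C c d" "x \<in> Ob C" for c d x
    using cone_class_transport(3)[OF that(1-3)] that(4) by (auto simp: is_cone_def Hom_def)
  have \<Phi>: "CC_morphism C ?R C' ?R' (F, restrict ((`) cone_map) ?R)"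
    unfolding CC_morphism_def split_conv
    using connected_by_all_classes C'.connected_by_all_classes F inc mono val
    by (auto simp: monotone_on_def R cone_class_transport F_def)
  have \<Psi>: "CC_morphism C' ?R' C ?R (F', restrict G' ?R')"
    unfolding CC_morphism_def split_conv
    using connected_by_all_classes C'.connected_by_all_classes F' inc mono val
    by (auto simp: monotone_on_def R cone_class_transport F'_def Ob_image Ar_image)
  have "CC_comp C ?R (F, restrict ((`) cone_map) ?R) (F', restrict G' ?R') = CC_id C ?R"
    by (auto simp: CC_comp_def CC_id_def F_def F'_def compose_def Ob_image Ar_image R intro!: restrict_ext)
  moreover have "CC_comp C' ?R' (F', restrict G' ?R') (F, restrict ((`) cone_map) ?R) = CC_id C' ?R'"
    by (auto simp: CC_comp_def CC_id_def F_def F'_def compose_def Ob_image Ar_image R intro!: restrict_ext)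
  ultimately show ?thesis
    using \<Phi> \<Psi> unfolding CC_isomorphic_def by blast
qed

end

section \<open>The category of subspaces\<close>

locale subspace_category = vector_space scale
  for scale :: "'k::field \<Rightarrow> 'v::ab_group_add \<Rightarrow> 'v"
begin

section \<open>Linear maps, sections and projections\<close>

abbreviation lin :: "('v \<Rightarrow> 'v) \<Rightarrow> bool" where
  "lin \<equiv> Vector_Spaces.linear scale scale"

lemma lin_iff: "lin T \<longleftrightarrow> (\<forall>x y. T (x + y) = T x + T y) \<and> (\<forall>c x. T (scale c x) = scale c (T x))"
  by (simp add: Vector_Spaces.linear_iff vector_space_axioms)

lemma lin_comp: "lin T \<Longrightarrow> lin U \<Longrightarrow> lin (U \<circ> T)"
  by (simp add: lin_iff)

lemma lin_ident: "lin (\<lambda>x. x)"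
  by (simp add: lin_iff)

lemma lin_zero: "lin T \<Longrightarrow> T 0 = 0"
  by (metis add_cancel_right_right lin_iff)

lemma lin_diff: "lin T \<Longrightarrow> T (x - y) = T x - T y"
  by (metis add_diff_cancel_right' diff_add_cancel lin_iff)

lemma lin_subspace_image: "lin T \<Longrightarrow> subspace A \<Longrightarrow> subspace (T ` A)"
  by (rule module_hom.subspace_image) (simp_all add: module_hom_iff_linear)

text \<open>This is the source of the linear maps constructed below: projections, complements of
  kernels, and factorisations through a map with smaller kernel.\<close>

lemma lin_section:
  assumes "lin T" "subspace A"
  obtains g where "lin g" "range g \<subseteq> A" "\<And>y. y \<in> T ` A \<Longrightarrow> T (g y) = y"
proof -
  interpret vector_space_pair scale scale ..
  show ?thesis
    using linear_exists_right_inverse_on[OF assms] that by auto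
qed

definition proj :: "'v set \<Rightarrow> 'v \<Rightarrow> 'v" where
  "proj A = (SOME P. lin P \<and> range P \<subseteq> A \<and> (\<forall>x\<in>A. P x = x))"

text \<open>A linear section of the identity over \<open>A\<close> with values in \<open>A\<close>
  is a projection onto \<open>A\<close>, so the choice in \<open>proj\<close> has a witness.\<close>

lemma proj:
  assumes "subspace A"
  shows "lin (proj A)" "proj A x \<in> A" "x \<in> A \<Longrightarrow> proj A x = x"
proof -
  obtain P where "lin P" "range P \<subseteq> A" "\<And>y. y \<in> (\<lambda>x. x) ` A \<Longrightarrow> P y = y"
    using lin_section[OF lin_ident assms] by metis
  then have "\<exists>P. lin P \<and> range P \<subseteq> A \<and> (\<forall>x\<in>A. P x = x)"
    by auto
  from someI_ex[OF this]
  show "lin (proj A)" "proj A x \<in> A" "x \<in> A \<Longrightarrow> proj A x = x"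
    by (auto simp: proj_def)
qed

lemma range_proj: "subspace A \<Longrightarrow> range (proj A) = A"
  by (metis image_subset_iff proj(2,3) rangeI subsetI subset_antisym)

section \<open>Subspaces, inclusions and normal factorisations\<close>

abbreviation \<V> :: "('v set, 'v arrow) subobj_cat" where
  "\<V> \<equiv> subspace_cat scale"

text \<open>Composing with a projection extends every linear map on a subspace to the whole space,
  so the arrows are the restrictions of linear transformations.\<close>

definition arr :: "'v set \<Rightarrow> ('v \<Rightarrow> 'v) \<Rightarrow> 'v set \<Rightarrow> 'v arrow" where
  "arr A T B = (A, restrict T A, B)"

lemma arr_eq_iff: "arr A T B = arr A' U B' \<longleftrightarrow> A = A' \<and> B = B' \<and> (\<forall>x\<in>A. T x = U x)"
  by (auto simp: arr_def restrict_def fun_eq_iff)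

lemma Ob_V: "Ob \<V> = {A. subspace A}"
  by (simp add: subspace_cat_def map_cat_def)

lemma Dom_arr [simp]: "Dom \<V> (arr A T B) = A"
  and Cod_arr [simp]: "Cod \<V> (arr A T B) = B"
  by (simp_all add: subspace_cat_def map_cat_def arr_def)

lemma Idn_V: "Idn \<V> A = arr A (\<lambda>x. x) A"
  by (simp add: subspace_cat_def map_cat_def arr_def)

lemma Cmp_arr: "T ` A \<subseteq> B \<Longrightarrow> Cmp \<V> (arr A T B) (arr B U D) = arr A (U \<circ> T) D"
  by (auto simp: subspace_cat_def map_cat_def arr_def compose_def restrict_def fun_eq_iff image_subset_iff)

lemma Inc_V: "Inc \<V> = {arr A (\<lambda>x. x) B | A B. subspace A \<and> subspace B \<and> A \<subseteq> B}"
  by (simp add: subspace_cat_def map_cat_def arr_def)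

lemma Ar_V: "Ar \<V> = {arr A T B | A T B. subspace A \<and> subspace B \<and> lin T \<and> T ` A \<subseteq> B}"
  (is "_ = ?R")
proof (intro equalityI subsetI)
  fix a assume "a \<in> Ar \<V>"
  then obtain A f B where a: "a = (A, f, B)" "subspace A" "subspace B" "f \<in> linear_maps scale A B"
    by (auto simp: subspace_cat_def map_cat_def)
  have f: "f \<in> A \<rightarrow>\<^sub>E B" "\<And>x y. x \<in> A \<Longrightarrow> y \<in> A \<Longrightarrow> f (x + y) = f x + f y"
    "\<And>c x. x \<in> A \<Longrightarrow> f (scale c x) = scale c (f x)"
    using a(4) by (auto simp: linear_maps_def)
  note P = proj[OF a(2)]
  have "lin (f \<circ> proj A)"
    using f P by (simp add: lin_iff)
  moreover have "f = restrict (f \<circ> proj A) A"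
    using f(1) P by (auto simp: fun_eq_iff restrict_def PiE_def extensional_def)
  moreover have "(f \<circ> proj A) ` A \<subseteq> B"
    using f(1) P by auto
  ultimately show "a \<in> ?R"
    using a(1-3) unfolding arr_def by blast
next
  fix a assume "a \<in> ?R"
  then obtain A T B where a: "a = arr A T B" "subspace A" "subspace B" "lin T" "T ` A \<subseteq> B"
    by blast
  then have "restrict T A \<in> linear_maps scale A B"
    by (auto simp: linear_maps_def lin_iff subspace_add subspace_scale)
  then show "a \<in> Ar \<V>"
    using a by (auto simp: arr_def subspace_cat_def map_cat_def)
qed

lemma arr_in_Hom: "subspace A \<Longrightarrow> subspace B \<Longrightarrow> lin T \<Longrightarrow> T ` A \<subseteq> B \<Longrightarrow> arr A T B \<in> Hom \<V> A B"
  by (auto simp: Hom_def Ar_V)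

lemma Hom_VE:
  assumes "f \<in> Hom \<V> A B"
  obtains T where "f = arr A T B" "lin T" "T ` A \<subseteq> B" "subspace A" "subspace B"
  using assms by (auto simp: Hom_def Ar_V)

lemma incl_in_Hom:
  "subspace A \<Longrightarrow> subspace B \<Longrightarrow> A \<subseteq> B \<Longrightarrow> arr A (\<lambda>x. x) B \<in> Inc \<V> \<inter> Hom \<V> A B"
  using arr_in_Hom[OF _ _ lin_ident] unfolding Inc_V by blast

lemma category_V: "category \<V>"
proof
  show "Dom \<V> f \<in> Ob \<V>" "Cod \<V> f \<in> Ob \<V>" if "f \<in> Ar \<V>" for f
    using that by (auto simp: Ar_V Ob_V)
  show "Idn \<V> A \<in> Hom \<V> A A" if "A \<in> Ob \<V>" for A
    using that by (auto simp: Ob_V Idn_V intro!: arr_in_Hom lin_ident)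
  fix f A B assume "f \<in> Hom \<V> A B"
  then obtain T where T: "f = arr A T B" "lin T" "T ` A \<subseteq> B" "subspace A" "subspace B"
    by (rule Hom_VE)
  show "Cmp \<V> (Idn \<V> A) f = f" "Cmp \<V> f (Idn \<V> B) = f"
    using T by (simp_all add: Idn_V Cmp_arr arr_eq_iff)
  fix g D assume "g \<in> Hom \<V> B D"
  then obtain U where U: "g = arr B U D" "lin U" "U ` B \<subseteq> D" "subspace D"
    by (rule Hom_VE)
  have UT: "(U \<circ> T) ` A \<subseteq> D"
    using T U by auto
  then show "Cmp \<V> f g \<in> Hom \<V> A D"
    using T U by (simp add: Cmp_arr arr_in_Hom lin_comp)
  fix h E assume "h \<in> Hom \<V> D E"
  then obtain W where "h = arr D W E"
    by (rule Hom_VE)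
  then show "Cmp \<V> (Cmp \<V> f g) h = Cmp \<V> f (Cmp \<V> g h)"
    using T U UT by (simp add: Cmp_arr comp_assoc)
qed

lemma isomorphism_arrI:
  assumes "subspace A" "subspace B" "lin T" "T ` A \<subseteq> B" "lin U" "U ` B \<subseteq> A"
    "\<And>x. x \<in> A \<Longrightarrow> U (T x) = x" "\<And>y. y \<in> B \<Longrightarrow> T (U y) = y"
  shows "isomorphism \<V> (arr A T B)"
proof -
  have "arr B U A \<in> Hom \<V> B A" "arr A T B \<in> Ar \<V>"
    using assms arr_in_Hom by (auto simp: Hom_def)
  then show ?thesis
    using assms unfolding isomorphism_def
    by (auto simp: Cmp_arr Idn_V arr_eq_iff intro!: bexI[of _ "arr B U A"])
qed

lemma isomorphism_arr_onto:
  assumes "isomorphism \<V> (arr A T B)" "T ` A \<subseteq> B"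
  shows "T ` A = B"
proof -
  from assms(1) obtain g where g: "g \<in> Hom \<V> B A" "Cmp \<V> g (arr A T B) = Idn \<V> B"
    by (auto simp: isomorphism_def)
  then obtain U where "g = arr B U A" "U ` B \<subseteq> A"
    by (elim Hom_VE)
  then have "U ` B \<subseteq> A" "\<And>y. y \<in> B \<Longrightarrow> T (U y) = y"
    using g by (auto simp: Cmp_arr Idn_V arr_eq_iff)
  then show ?thesis
    using assms(2) by (metis image_eqI image_subset_iff subsetI subset_antisym)
qed

lemma strict_preorder_inclusions: "strict_preorder (inclusion_cat \<V>)"
proof -
  interpret V: category \<V> by (rule category_V)
  let ?I = "inclusion_cat \<V>"
  have hom: "Hom ?I A B = {f. f = arr A (\<lambda>x. x) B \<and> subspace A \<and> subspace B \<and> A \<subseteq> B}" for A B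
    by (auto simp: Hom_def inclusion_cat_def Inc_V)
  have sub: "Hom ?I A B \<subseteq> Hom \<V> A B" for A B
    by (auto simp: hom intro!: arr_in_Hom lin_ident)
  have I: "Dom ?I = Dom \<V>" "Cod ?I = Cod \<V>" "Idn ?I = Idn \<V>" "Cmp ?I = Cmp \<V>" "Ar ?I = Inc \<V>" "Ob ?I = Ob \<V>"
    by (simp_all add: inclusion_cat_def)
  have "category ?I"
  proof
    show "Dom ?I f \<in> Ob ?I" "Cod ?I f \<in> Ob ?I" if "f \<in> Ar ?I" for f
      using that by (auto simp: I Inc_V Ob_V)
    show "Idn ?I A \<in> Hom ?I A A" if "A \<in> Ob ?I" for A
      using that by (auto simp: I hom Idn_V Ob_V)
    show "Cmp ?I f g \<in> Hom ?I A D" if "f \<in> Hom ?I A B" "g \<in> Hom ?I B D" for f g A B D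
      using that by (auto simp: I hom Cmp_arr comp_def)
    show "Cmp ?I (Idn ?I A) f = f" "Cmp ?I f (Idn ?I B) = f" if "f \<in> Hom ?I A B" for f A B
      using that sub V.Idn_left V.Idn_right unfolding I by blast+
    show "Cmp ?I (Cmp ?I f g) h = Cmp ?I f (Cmp ?I g h)"
      if "f \<in> Hom ?I A B" "g \<in> Hom ?I B D" "h \<in> Hom ?I D E" for f g h A B D E
      using that sub V.Cmp_assoc unfolding I by blast
  qed
  moreover have "f = Idn ?I (Dom ?I f)" if iso: "f \<in> Ar ?I" "isomorphism ?I f" for f
  proof -
    obtain A B where f: "f = arr A (\<lambda>x. x) B" "A \<subseteq> B"
      using iso(1) by (auto simp: I Inc_V)
    \<comment> \<open>An inverse within the category of inclusions is itself an inclusion, of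
      \<open>B\<close> into \<open>A\<close>.\<close>
    then have "B \<subseteq> A"
      using iso(2) by (auto simp: isomorphism_def I hom)
    then show ?thesis
      using f by (simp add: I Idn_V arr_eq_iff)
  qed
  ultimately show ?thesis
    by (auto simp: strict_preorder_def hom)
qed

lemma category_with_subobjects_V: "category_with_subobjects \<V>"
proof -
  interpret V: category \<V> by (rule category_V)
  show ?thesis
  proof
    show Inc_Ar: "Inc \<V> \<subseteq> Ar \<V>"
      using lin_ident by (auto simp: Inc_V Ar_V)
    show "monomorphism \<V> f" if f: "f \<in> Inc \<V>" for f
      unfolding monomorphism_def
    proof (intro conjI ballI impI)
      show "f \<in> Ar \<V>"
        using f Inc_Ar by blast
      fix A g h assume g: "g \<in> Hom \<V> A (Dom \<V> f)" and h: "h \<in> Hom \<V> A (Dom \<V> f)"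
        and eq: "Cmp \<V> g f = Cmp \<V> h f"
      obtain B D where "f = arr B (\<lambda>x. x) D"
        using f by (auto simp: Inc_V)
      with g h eq show "g = h"
        by (elim Hom_VE) (simp add: Cmp_arr arr_eq_iff)
    qed
    show "strict_preorder (inclusion_cat \<V>)"
      by (rule strict_preorder_inclusions)
    show "h \<in> Inc \<V>"
      if fgh: "f \<in> Inc \<V>" "g \<in> Inc \<V>" "h \<in> Hom \<V> (Dom \<V> f) (Dom \<V> g)" "f = Cmp \<V> h g" for f g h
    proof -
      obtain A B where f: "f = arr A (\<lambda>x. x) B"
        using fgh by (auto simp: Inc_V)
      obtain A' B' where g: "g = arr A' (\<lambda>x. x) B'"
        using fgh by (auto simp: Inc_V)
      obtain T where T: "h = arr A T A'" "lin T" "T ` A \<subseteq> A'" "subspace A" "subspace A'"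
        using fgh(3) unfolding f g Dom_arr by (rule Hom_VE)
      then have "\<And>x. x \<in> A \<Longrightarrow> T x = x"
        using fgh f g by (auto simp: Cmp_arr arr_eq_iff)
      then have "h = arr A (\<lambda>x. x) A'" "A \<subseteq> A'"
        using T by (auto simp: arr_eq_iff)
      then show ?thesis
        using T by (auto simp: Inc_V)
    qed
  qed
qed

text \<open>A linear section of \<open>T\<close> on \<open>A\<close> maps \<open>T ` A\<close> onto a complement \<open>D\<close> of the kernel in \<open>A\<close>.\<close>

lemma normal_factorisation_arr:
  assumes "subspace A" "subspace B" "lin T" "T ` A \<subseteq> B"
  obtains q u D where "normal_factorisation \<V> (arr A T B) q u (arr (T ` A) (\<lambda>x. x) B)"
    "Cmp \<V> q u = arr A T (T ` A)" "subspace D" "u = arr D T (T ` A)" "D \<subseteq> A"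
proof -
  obtain g where g: "lin g" "range g \<subseteq> A" "\<And>y. y \<in> T ` A \<Longrightarrow> T (g y) = y"
    using lin_section[OF assms(3,1)] by metis
  define D where "D = g ` T ` A"
  have TA: "subspace (T ` A)" and D: "subspace D" "D \<subseteq> A"
    using assms g lin_subspace_image by (auto simp: D_def)
  \<comment> \<open>The retraction is \<open>g \<circ> T\<close>, since \<open>g (T x) = x\<close>
    on \<open>D\<close>; the isomorphism is \<open>T\<close> on \<open>D\<close>, with inverse
    \<open>g\<close>.\<close>
  let ?q = "arr A (g \<circ> T) D" and ?u = "arr D T (T ` A)"
  have gTA: "(g \<circ> T) ` A \<subseteq> D"
    by (auto simp: D_def)
  have fix_D: "x \<in> D \<Longrightarrow> g (T x) = x" for x
    using g(3) by (auto simp: D_def)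
  have "isomorphism \<V> ?u"
    by (rule isomorphism_arrI[where U = g]) (use D TA g assms fix_D in \<open>auto simp: D_def\<close>)
  moreover have "retraction_of \<V> (arr D (\<lambda>x. x) A) ?q"
    using D assms gTA g fix_D lin_comp
    by (auto simp: retraction_of_def Idn_V Cmp_arr arr_eq_iff intro!: arr_in_Hom)
  then have "retraction \<V> ?q"
    using D assms(1) incl_in_Hom unfolding retraction_def by blast
  moreover have "Cmp \<V> ?q ?u = arr A T (T ` A)"
    using g(3) gTA by (simp add: Cmp_arr arr_eq_iff)
  moreover have "Cmp \<V> (arr A T (T ` A)) (arr (T ` A) (\<lambda>x. x) B) = arr A T B"
    by (simp add: Cmp_arr arr_eq_iff)
  ultimately have "normal_factorisation \<V> (arr A T B) ?q ?u (arr (T ` A) (\<lambda>x. x) B)"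
    using incl_in_Hom[OF TA assms(2,4)] by (simp add: normal_factorisation_def)
  then show ?thesis
    using that[of ?q ?u D] \<open>Cmp \<V> ?q ?u = arr A T (T ` A)\<close> D by blast
qed

subsection \<open>The semigroup of cones\<close>

definition cone_of :: "('v \<Rightarrow> 'v) \<Rightarrow> 'v set \<Rightarrow> 'v arrow" where
  "cone_of T = (\<lambda>A\<in>{A. subspace A}. arr A T (range T))"

lemma incl_V:
  assumes "subspace A" "subspace B" "subobj_le \<V> A B"
  shows "incl \<V> A B = arr A (\<lambda>x. x) B" "A \<subseteq> B"
proof -
  interpret category_with_subobjects \<V> by (rule category_with_subobjects_V)
  show "A \<subseteq> B"
    using assms by (auto simp: subobj_le_def Inc_V Hom_def)
  then have "arr A (\<lambda>x. x) B \<in> Inc \<V> \<inter> Hom \<V> A B"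
    using assms incl_in_Hom by blast
  then show "incl \<V> A B = arr A (\<lambda>x. x) B"
    by (rule incl_eq)
qed

text \<open>Restrictions of a single map are compatible with inclusions. The component at the
  complement \<open>D\<close> of the kernel, taken from the normal factorisation of \<open>T\<close>
  on the whole space, is an isomorphism.\<close>

lemma is_cone_cone_of:
  assumes "lin T"
  shows "is_cone \<V> (range T) (cone_of T)"
proof -
  have R: "subspace (range T)"
    using assms lin_subspace_image by auto
  obtain u D where "isomorphism \<V> (arr D T (range T))" "subspace D"
    using normal_factorisation_arr[OF subspace_UNIV R assms]
    by (metis normal_factorisation_def order_refl)
  then show ?thesis
    using R assms incl_V
    by (auto simp: is_cone_def Ob_V cone_of_def Cmp_arr arr_eq_iff intro!: arr_in_Hom)
qed

text \<open>A cone is determined by its component at the whole space, which is onto because some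
  component is an isomorphism.\<close>

lemma is_coneE:
  assumes "is_cone \<V> z \<gamma>"
  obtains T where "lin T" "z = range T" "\<gamma> = cone_of T"
proof -
  have hom: "\<And>A. subspace A \<Longrightarrow> \<gamma> A \<in> Hom \<V> A z" and ext: "\<gamma> \<in> extensional {A. subspace A}"
    and compat: "\<And>A B. subspace A \<Longrightarrow> subspace B \<Longrightarrow> subobj_le \<V> A B \<Longrightarrow> Cmp \<V> (incl \<V> A B) (\<gamma> B) = \<gamma> A"
    and iso: "\<exists>A. subspace A \<and> isomorphism \<V> (\<gamma> A)"
    using assms by (auto simp: is_cone_def Ob_V)
  obtain T where T: "\<gamma> UNIV = arr UNIV T z" "lin T" "range T \<subseteq> z"
    using hom[OF subspace_UNIV] by (elim Hom_VE)
  have \<gamma>: "\<gamma> A = arr A T z" if "subspace A" for A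
  proof -
    have "arr A (\<lambda>x. x) UNIV \<in> Inc \<V> \<inter> Hom \<V> A UNIV"
      using that incl_in_Hom by simp
    then have "subobj_le \<V> A UNIV"
      by (auto simp: subobj_le_def)
    then show ?thesis
      using compat[OF that subspace_UNIV] incl_V[OF that subspace_UNIV] T
      by (simp add: Cmp_arr arr_eq_iff comp_def)
  qed
  then obtain A where "isomorphism \<V> (arr A T z)"
    using iso by metis
  then have "T ` A = z"
    using T(3) by (intro isomorphism_arr_onto) auto
  then have z: "z = range T"
    using T(3) by auto
  moreover have "\<gamma> = cone_of T"
    using ext by (rule extensionalityI) (auto simp: cone_of_def \<gamma> z)
  ultimately show ?thesis
    using that T(2) by blast
qed

text \<open>An inclusion is split by a projection restricted to the larger subspace, and the cone of
  \<open>proj A\<close> is the identity at \<open>A\<close>. Factorisations come from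
  \<open>normal_factorisation_arr\<close>.\<close>

lemma normal_category_V: "normal_category \<V>"
proof -
  interpret V: category_with_subobjects \<V> by (rule category_with_subobjects_V)
  show ?thesis
  proof
    fix j assume "j \<in> Inc \<V>"
    then obtain A B where j: "j = arr A (\<lambda>x. x) B" "subspace A" "subspace B" "A \<subseteq> B"
      by (auto simp: Inc_V)
    then have "retraction_of \<V> j (arr B (proj A) A)"
      using proj[OF j(2)] by (auto simp: retraction_of_def Cmp_arr Idn_V arr_eq_iff intro!: arr_in_Hom)
    then show "\<exists>q. retraction_of \<V> j q"
      by blast
  next
    fix f assume "f \<in> Ar \<V>"
    then obtain A B T where "f = arr A T B" "subspace A" "subspace B" "lin T" "T ` A \<subseteq> B"
      by (auto simp: Ar_V)
    then show "\<exists>q u j. normal_factorisation \<V> f q u j"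
      by (metis normal_factorisation_arr)
  next
    show "\<exists>\<mu>. is_cone \<V> A \<mu> \<and> \<mu> A = Idn \<V> A" if "A \<in> Ob \<V>" for A
      using that is_cone_cone_of[OF proj(1)] range_proj
      by (intro exI[of _ "cone_of (proj A)"]) (auto simp: Ob_V cone_of_def Idn_V arr_eq_iff proj(3))
  qed
qed

lemma bounded_above_V: "bounded_above \<V>"
proof -
  have "arr A (\<lambda>x. x) UNIV \<in> Inc \<V> \<inter> Hom \<V> A UNIV" if "subspace A" for A
    using that incl_in_Hom by simp
  then show ?thesis
    unfolding bounded_above_def subobj_le_def Ob_V by (intro bexI[of _ UNIV]) auto
qed

lemma epi_part_arr:
  assumes "subspace A" "subspace B" "lin T" "T ` A \<subseteq> B"
  shows "epi_part \<V> (arr A T B) = arr A T (T ` A)"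
proof -
  interpret normal_category \<V> by (rule normal_category_V)
  show ?thesis
    using normal_factorisation_arr[OF assms] epi_part_eq by metis
qed

lemma Car_cones: "Car (cone_sgrp \<V>) = cone_of ` {T. lin T}"
  using is_cone_cone_of by (auto simp: cone_sgrp_def elim!: is_coneE)

lemma vertex_cone_of: "lin T \<Longrightarrow> vertex \<V> (cone_of T) = range T"
  by (rule is_cone_vertex[OF is_cone_cone_of])

lemma cone_of_eq_iff: "cone_of T = cone_of U \<longleftrightarrow> T = U"
proof
  assume "cone_of T = cone_of U"
  then have "cone_of T UNIV = cone_of U UNIV"
    by simp
  then show "T = U"
    by (simp add: cone_of_def arr_eq_iff fun_eq_iff)
qed simp

text \<open>At the vertex \<open>range T\<close> the second cone has as epimorphic part
  \<open>U\<close> with codomain cut down to the image of \<open>range T\<close>. This image is the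
  range of \<open>U \<circ> T\<close>, the vertex required.\<close>

lemma Mul_cone_of:
  assumes "lin T" "lin U"
  shows "Mul (cone_sgrp \<V>) (cone_of T) (cone_of U) = cone_of (U \<circ> T)"
proof -
  have R: "subspace (range T)" "subspace (range U)" "U ` range T \<subseteq> range U"
    using assms lin_subspace_image by auto
  have "Mul (cone_sgrp \<V>) (cone_of T) (cone_of U) = cone_comp \<V> (cone_of T) (arr (range T) U (U ` range T))"
    using assms R by (simp add: cone_sgrp_def vertex_cone_of epi_part_arr cone_of_def[of U])
  also have "\<dots> = cone_of (U \<circ> T)"
    by (auto simp: cone_comp_def cone_of_def Ob_V Cmp_arr image_comp intro!: restrict_ext)
      (simp add: Cmp_arr image_subset_iff)
  finally show ?thesis .
qed

lemma principal_right_cones: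
  assumes "lin T"
  shows "principal_right (cone_sgrp \<V>) (cone_of T) = {cone_of (W \<circ> T) | W. lin W}"
proof -
  have "principal_right (cone_sgrp \<V>) (cone_of T) = insert (cone_of T) {cone_of (W \<circ> T) | W. lin W}"
    by (simp add: principal_right_def Car_cones setcompr_eq_image image_image Mul_cone_of[OF assms]
        cong: image_cong_simp)
  \<comment> \<open>The adjoined generator adds nothing: it arises from \<open>W\<close> the
    identity map.\<close>
  moreover have "cone_of T \<in> {cone_of (W \<circ> T) | W. lin W}"
    unfolding mem_Collect_eq by (rule exI[of _ "\<lambda>x. x"]) (simp add: lin_ident comp_def)
  ultimately show ?thesis
    by (simp only: insert_absorb)
qed

text \<open>One implication reads off \<open>T = W \<circ> U\<close>. For the other, a linear
  section \<open>g\<close> of \<open>U\<close> gives \<open>T = (T \<circ> g) \<circ> U\<close>,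
  because \<open>g (U x) - x\<close> lies in the kernel of \<open>U\<close> and hence of
  \<open>T\<close>.\<close>

lemma principal_right_cones_le_iff:
  assumes "lin T" "lin U"
  shows "principal_right (cone_sgrp \<V>) (cone_of T) \<subseteq> principal_right (cone_sgrp \<V>) (cone_of U) \<longleftrightarrow>
    {x. U x = 0} \<subseteq> {x. T x = 0}"
proof
  assume "principal_right (cone_sgrp \<V>) (cone_of T) \<subseteq> principal_right (cone_sgrp \<V>) (cone_of U)"
  then have "cone_of T \<in> principal_right (cone_sgrp \<V>) (cone_of U)"
    by (auto simp: principal_right_def)
  then obtain W where "lin W" "T = W \<circ> U"
    using principal_right_cones[OF assms(2)] by (auto simp: cone_of_eq_iff)
  then show "{x. U x = 0} \<subseteq> {x. T x = 0}"
    by (auto simp: lin_zero)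
next
  assume ker: "{x. U x = 0} \<subseteq> {x. T x = 0}"
  obtain g where g: "lin g" "\<And>y. y \<in> range U \<Longrightarrow> U (g y) = y"
    using lin_section[OF assms(2) subspace_UNIV] by metis
  have "T (g (U x)) = T x" for x
  proof -
    have "U (g (U x) - x) = 0"
      using g assms by (simp add: lin_diff)
    then have "T (g (U x) - x) = 0"
      using ker by blast
    then show ?thesis
      using assms by (simp add: lin_diff)
  qed
  then have T: "T = (T \<circ> g) \<circ> U"
    by (simp add: fun_eq_iff)
  have "lin (W \<circ> (T \<circ> g))" "cone_of (W \<circ> T) = cone_of ((W \<circ> (T \<circ> g)) \<circ> U)" if "lin W" for W
    using that assms g(1) T by (auto simp: lin_comp comp_assoc)
  then show "principal_right (cone_sgrp \<V>) (cone_of T) \<subseteq> principal_right (cone_sgrp \<V>) (cone_of U)"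
    unfolding principal_right_cones[OF assms(1)] principal_right_cones[OF assms(2)] by blast
qed

lemma null_spaces_order_iso:
  "\<exists>\<theta>. order_iso (null_spaces scale) (\<lambda>M N. N \<subseteq> M) (cone_classes \<V>) (cone_class_le \<V>) \<theta>"
proof -
  \<comment> \<open>An arrow is a triple, so \<open>fst (snd ...)\<close> extracts its map; the
    invariant of a cone is the kernel of its component at the whole space.\<close>
  define k where "k \<gamma> = {x. fst (snd (\<gamma> UNIV)) x = 0}" for \<gamma> :: "'v set \<Rightarrow> 'v arrow"
  have k: "k (cone_of T) = {x. T x = 0}" for T
    by (simp add: k_def cone_of_def arr_def)
  have "order_iso (null_spaces scale) (\<lambda>M N. N \<subseteq> M) (cone_classes \<V>) (cone_class_le \<V>)
      (\<lambda>N. {\<gamma> \<in> Car (cone_sgrp \<V>). k \<gamma> = N})"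
    by (rule order_iso_R_classes)
      (force simp: Car_cones null_spaces_def k image_image,
        clarsimp simp: Car_cones k principal_right_cones_le_iff, blast)
  then show ?thesis
    by blast
qed

lemma cones_closed:
  "\<gamma> \<in> Car (cone_sgrp \<V>) \<Longrightarrow> \<delta> \<in> Car (cone_sgrp \<V>) \<Longrightarrow> Mul (cone_sgrp \<V>) \<gamma> \<delta> \<in> Car (cone_sgrp \<V>)"
  by (auto simp: Car_cones Mul_cone_of lin_comp)

text \<open>A linear projection is determined by its kernel and its image.\<close>

lemma idempotent_cones_unique:
  assumes "\<gamma> \<in> idempotents (cone_sgrp \<V>)" "\<delta> \<in> idempotents (cone_sgrp \<V>)"
    and v: "vertex \<V> \<gamma> = vertex \<V> \<delta>"
    and pr: "principal_right (cone_sgrp \<V>) \<gamma> = principal_right (cone_sgrp \<V>) \<delta>"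
  shows "\<gamma> = \<delta>"
proof -
  obtain T U where T: "lin T" "\<gamma> = cone_of T" and U: "lin U" "\<delta> = cone_of U"
    using assms(1,2) by (auto simp: idempotents_def Car_cones)
  have "T \<circ> T = T" "U \<circ> U = U"
    using assms(1,2) T U by (simp_all add: idempotents_def Mul_cone_of cone_of_eq_iff)
  then have T2: "\<And>x. T (T x) = T x" and U2: "\<And>x. U (U x) = U x"
    by (metis comp_apply)+
  have ker: "{x. U x = 0} \<subseteq> {x. T x = 0}"
    using principal_right_cones_le_iff[OF T(1) U(1)] pr T U by simp
  have ran: "range T = range U"
    using v T U by (simp add: vertex_cone_of)
  have "T x = U x" for x
  proof -
    \<comment> \<open>\<open>x - U x\<close> lies in the kernel of \<open>U\<close>, hence of
      \<open>T\<close>; and \<open>U x\<close> lies in the common range, on which \<open>T\<close>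
      acts as the identity.\<close>
    have "U (x - U x) = 0"
      using U by (simp add: lin_diff U2)
    then have "T x = T (U x)"
      using ker T by (auto simp: lin_diff)
    moreover obtain y where "U x = T y"
      using ran by (metis rangeE rangeI)
    ultimately show ?thesis
      using T2 by simp
  qed
  then have "T = U"
    by (rule ext)
  then show ?thesis
    using T U by simp
qed

subsection \<open>Principal left ideals of linear transformations\<close>

abbreviation LT :: "('v \<Rightarrow> 'v) sgrp" where
  "LT \<equiv> LT_sgrp scale"

abbreviation \<L> :: "(('v \<Rightarrow> 'v) set, ('v \<Rightarrow> 'v) arrow) subobj_cat" where
  "\<L> \<equiv> left_ideal_cat LT"

text \<open>For a subspace \<open>A\<close> this is the principal left ideal generated by any
  idempotent with range \<open>A\<close>; see \<open>principal_left_LT\<close>.\<close>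

definition maps_into :: "'v set \<Rightarrow> ('v \<Rightarrow> 'v) set" where
  "maps_into A = {T. lin T \<and> range T \<subseteq> A}"

text \<open>Postcomposition is right multiplication in the diagrammatic product of the monoid, which
  is why these arrows match the right translations between ideals.\<close>

definition post_comp :: "'v arrow \<Rightarrow> ('v \<Rightarrow> 'v) arrow" where
  "post_comp = (\<lambda>(A, f, B). (maps_into A, (\<lambda>X\<in>maps_into A. f \<circ> X), maps_into B))"

lemma Car_LT: "Car LT = {T. lin T}" and Mul_LT: "Mul LT T U = U \<circ> T"
  by (simp_all add: LT_sgrp_def)

lemma idempotents_LT: "idempotents LT = {E. lin E \<and> (\<forall>x. E (E x) = E x)}"
  by (auto simp: idempotents_def Car_LT Mul_LT fun_eq_iff)

lemma proj_idempotent: "subspace A \<Longrightarrow> proj A \<in> idempotents LT"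
  by (simp add: idempotents_LT proj)

lemma subspace_range: "E \<in> idempotents LT \<Longrightarrow> subspace (range E)"
  using lin_subspace_image by (auto simp: idempotents_LT)

lemma idempotent_fixes: "E \<in> idempotents LT \<Longrightarrow> x \<in> range E \<Longrightarrow> E x = x"
  by (auto simp: idempotents_LT)

text \<open>The idempotent \<open>E\<close> fixes its range pointwise, so a \<open>T\<close> with
  values there satisfies \<open>T = E \<circ> T\<close>, a left multiple of \<open>E\<close> in the
  diagrammatic product.\<close>

lemma principal_left_LT:
  assumes "E \<in> idempotents LT"
  shows "principal_left LT E = maps_into (range E)"
proof (intro equalityI subsetI)
  fix T assume "T \<in> maps_into (range E)"
  then have T: "lin T" "range T \<subseteq> range E"
    by (simp_all add: maps_into_def)
  then have "T = E \<circ> T"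
    using idempotent_fixes[OF assms] by (metis comp_apply ext range_subsetD)
  then show "T \<in> principal_left LT E"
    using T(1) unfolding principal_left_def Mul_LT Car_LT by blast
next
  have "lin E"
    using assms by (simp add: idempotents_LT)
  fix T assume "T \<in> principal_left LT E"
  then obtain X where "T = E \<circ> X" "lin X"
    by (auto simp: principal_left_def Mul_LT Car_LT)
  then show "T \<in> maps_into (range E)"
    using lin_comp[OF \<open>lin X\<close> \<open>lin E\<close>] by (auto simp: maps_into_def)
qed

text \<open>\<open>proj A\<close> belongs to \<open>maps_into A\<close> and has range exactly
  \<open>A\<close>, so the ideal remembers the subspace.\<close>

lemma maps_into_subset_iff: "subspace A \<Longrightarrow> maps_into A \<subseteq> maps_into B \<longleftrightarrow> A \<subseteq> B"
proof
  assume A: "subspace A" and sub: "maps_into A \<subseteq> maps_into B"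
  have "proj A \<in> maps_into A"
    using A by (simp add: maps_into_def proj(1) range_proj)
  then have "proj A \<in> maps_into B"
    using sub by blast
  then show "A \<subseteq> B"
    using A by (simp add: maps_into_def range_proj)
qed (auto simp: maps_into_def)

lemma maps_into_eq_iff: "subspace A \<Longrightarrow> subspace B \<Longrightarrow> maps_into A = maps_into B \<longleftrightarrow> A = B"
  by (metis maps_into_subset_iff order_refl subset_antisym)

text \<open>Members of \<open>maps_into A\<close> take values in \<open>A\<close>, so the
  restriction hidden in \<open>arr\<close> does not affect the composites.\<close>

lemma post_comp_arr:
  "post_comp (arr A T B) = (maps_into A, (\<lambda>X\<in>maps_into A. T \<circ> X), maps_into B)"
  by (auto simp: post_comp_def arr_def fun_eq_iff maps_into_def restrict_def image_subset_iff)

lemma right_translation_LT: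
  assumes "E \<in> idempotents LT" "F \<in> idempotents LT"
  shows "right_translation LT E U F = post_comp (arr (range E) U (range F))"
  using assms by (simp add: right_translation_def principal_left_LT post_comp_arr Mul_LT)

text \<open>The left ideal of an idempotent depends only on its range, and every subspace
  \<open>A\<close> is the range of the idempotent \<open>proj A\<close>.\<close>

lemma bij_maps_into: "bij_betw maps_into (Ob \<V>) (Ob \<L>)"
proof -
  have "A \<in> range ` idempotents LT" if "subspace A" for A
    using proj_idempotent[OF that] range_proj[OF that] by (metis imageI)
  then have "range ` idempotents LT = {A. subspace A}"
    using subspace_range by blast
  moreover have "Ob \<L> = maps_into ` range ` idempotents LT"
    by (simp add: left_ideal_cat_def map_cat_def principal_left_LT image_image cong: image_cong_simp)
  ultimately show ?thesis
    by (simp add: bij_betw_def inj_on_def Ob_V maps_into_eq_iff)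
qed

lemma inj_post_comp: "inj_on post_comp (Ar \<V>)"
proof (rule inj_onI)
  fix f g assume "f \<in> Ar \<V>" "g \<in> Ar \<V>" and eq: "post_comp f = post_comp g"
  then obtain A T B A' T' B' where f: "f = arr A T B" "subspace A" "subspace B"
    and g: "g = arr A' T' B'" "subspace A'" "subspace B'"
    by (auto simp: Ar_V)
  have AB: "A' = A" "B' = B"
    using eq f g by (auto simp: post_comp_arr maps_into_eq_iff)
  \<comment> \<open>The test map \<open>proj A\<close> lies in the ideal and fixes \<open>A\<close>,
    so the value of a translation there recovers the linear map on \<open>A\<close>.\<close>
  have "proj A \<in> maps_into A"
    using f by (simp add: maps_into_def proj(1) range_proj)
  then have "T \<circ> proj A = T' \<circ> proj A"
    using eq f g AB by (auto simp: post_comp_arr dest: fun_cong[of _ _ "proj A"])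
  then have "\<forall>x\<in>A. T x = T' x"
    using proj(3)[OF f(2)] by (metis comp_apply)
  then show "f = g"
    using f g AB by (simp add: arr_eq_iff)
qed

lemma Ar_left_ideal_cat: "Ar \<L> = post_comp ` Ar \<V>"
proof (intro equalityI subsetI)
  fix a assume "a \<in> Ar \<L>"
  then obtain E U F S where EF: "E \<in> idempotents LT" "F \<in> idempotents LT"
    and a: "a = right_translation LT E U F" and U: "U = F \<circ> (S \<circ> E)" "lin S"
    by (auto simp: left_ideal_cat_def map_cat_def Mul_LT Car_LT)
  have "lin U" "U ` range E \<subseteq> range F"
    using EF U by (auto simp: idempotents_LT lin_comp)
  then have "arr (range E) U (range F) \<in> Ar \<V>"
    using EF subspace_range unfolding Ar_V by blast
  then show "a \<in> post_comp ` Ar \<V>"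
    using a EF right_translation_LT by blast
next
  fix a assume "a \<in> post_comp ` Ar \<V>"
  then obtain A T B where a: "a = post_comp (arr A T B)" and AB: "subspace A" "subspace B"
    and T: "lin T" "T ` A \<subseteq> B"
    by (auto simp: Ar_V)
  \<comment> \<open>Multiplying by projections on both sides brings the map into the form required
    of a translation from \<open>proj A\<close> to \<open>proj B\<close>, without changing its
    values on \<open>A\<close>.\<close>
  let ?U = "Mul LT (Mul LT (proj A) T) (proj B)"
  have "arr A T B = arr A ?U B"
    using T(2) proj(3)[OF AB(1)] proj(3)[OF AB(2)] by (auto simp: arr_eq_iff Mul_LT)
  then have "a = right_translation LT (proj A) ?U (proj B)"
    using a AB by (simp add: right_translation_LT proj_idempotent range_proj)
  then show "a \<in> Ar \<L>"
    using AB proj_idempotent T(1) by (auto simp: left_ideal_cat_def map_cat_def Car_LT)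
qed

text \<open>An idempotent is the identity on its range, so translation by \<open>E\<close> comes
  from an inclusion of subspaces; containment of ideals is containment of ranges.\<close>

lemma Inc_left_ideal_cat: "Inc \<L> = post_comp ` Inc \<V>"
proof -
  have eq: "right_translation LT E E F = post_comp (arr (range E) (\<lambda>x. x) (range F))"
    if "E \<in> idempotents LT" "F \<in> idempotents LT" for E F
  proof -
    have "arr (range E) E (range F) = arr (range E) (\<lambda>x. x) (range F)"
      unfolding arr_eq_iff using idempotent_fixes[OF that(1)] by blast
    then show ?thesis
      using that by (simp add: right_translation_LT)
  qed
  have sub: "principal_left LT E \<subseteq> principal_left LT F \<longleftrightarrow> range E \<subseteq> range F"
    if "E \<in> idempotents LT" "F \<in> idempotents LT" for E F
    using that subspace_range by (simp add: principal_left_LT maps_into_subset_iff)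
  show ?thesis
  proof (intro equalityI subsetI)
    fix a assume "a \<in> Inc \<L>"
    then obtain E F where "E \<in> idempotents LT" "F \<in> idempotents LT"
      "a = right_translation LT E E F" "principal_left LT E \<subseteq> principal_left LT F"
      by (auto simp: left_ideal_cat_def map_cat_def)
    then show "a \<in> post_comp ` Inc \<V>"
      using eq sub incl_in_Hom subspace_range by simp
  next
    fix a assume "a \<in> post_comp ` Inc \<V>"
    then obtain A B where "a = post_comp (arr A (\<lambda>x. x) B)" "subspace A" "subspace B" "A \<subseteq> B"
      by (auto simp: Inc_V)
    then have "proj A \<in> idempotents LT" "proj B \<in> idempotents LT"
      "a = right_translation LT (proj A) (proj A) (proj B)"
      "principal_left LT (proj A) \<subseteq> principal_left LT (proj B)"
      using proj_idempotent by (simp_all add: eq sub range_proj)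
    then show "a \<in> Inc \<L>"
      by (auto simp: left_ideal_cat_def map_cat_def)
  qed
qed

section \<open>The isomorphism between subspaces and left ideals\<close>

lemma connected_cat_iso_LT: "connected_cat_iso \<V> \<L> maps_into post_comp"
proof -
  interpret normal_category \<V> by (rule normal_category_V)
  show ?thesis
  proof
    show "bij_betw maps_into (Ob \<V>) (Ob \<L>)"
      by (rule bij_maps_into)
    show "bij_betw post_comp (Ar \<V>) (Ar \<L>)"
      using inj_post_comp by (simp add: bij_betw_def Ar_left_ideal_cat)
    show "Inc \<L> = post_comp ` Inc \<V>"
      by (rule Inc_left_ideal_cat)
    show "Dom \<L> (post_comp f) = maps_into (Dom \<V> f)" "Cod \<L> (post_comp f) = maps_into (Cod \<V> f)"
      if "f \<in> Ar \<V>" for f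
      using that by (auto simp: Ar_V post_comp_arr left_ideal_cat_def map_cat_def)
    show "Idn \<L> (maps_into A) = post_comp (Idn \<V> A)" if "A \<in> Ob \<V>" for A
      by (simp add: Idn_V post_comp_arr left_ideal_cat_def map_cat_def comp_def)
    show "Cmp \<L> (post_comp f) (post_comp g) = post_comp (Cmp \<V> f g)"
      if fg: "f \<in> Ar \<V>" "g \<in> Ar \<V>" "Cod \<V> f = Dom \<V> g" for f g
    proof -
      obtain A T B U D where "f = arr A T B" "g = arr B U D" "lin T" "T ` A \<subseteq> B"
        using fg by (auto simp: Ar_V)
      moreover from this have "T \<circ> X \<in> maps_into B" if "X \<in> maps_into A" for X
        using that by (auto simp: maps_into_def lin_comp)
      ultimately show ?thesis
        by (auto simp: Cmp_arr post_comp_arr left_ideal_cat_def map_cat_def compose_def comp_assoc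
            intro!: restrict_ext)
    qed
    show "Mul (cone_sgrp \<V>) \<gamma> \<delta> \<in> Car (cone_sgrp \<V>)"
      if "\<gamma> \<in> Car (cone_sgrp \<V>)" "\<delta> \<in> Car (cone_sgrp \<V>)" for \<gamma> \<delta>
      using that by (rule cones_closed)
    show "\<gamma> = \<delta>" if "\<gamma> \<in> idempotents (cone_sgrp \<V>)" "\<delta> \<in> idempotents (cone_sgrp \<V>)"
      "vertex \<V> \<gamma> = vertex \<V> \<delta>"
      "principal_right (cone_sgrp \<V>) \<gamma> = principal_right (cone_sgrp \<V>) \<delta>" for \<gamma> \<delta>
      using that by (rule idempotent_cones_unique)
  qed
qed

lemma left_ideal_cat_isomorphic: "isomorphic_as_bounded_above \<L> \<V>"
proof -
  interpret connected_cat_iso \<V> \<L> maps_into post_comp by (rule connected_cat_iso_LT)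
  show ?thesis
    using normal_category_image normal_category_V bounded_above_V bounded_above_image
      CC_isomorphic_image by (simp add: isomorphic_as_bounded_above_def)
qed

end

theorem proposition7p12:
  fixes scale :: "'k::field \<Rightarrow> 'v::ab_group_add \<Rightarrow> 'v" and Basis :: "'v set"
  assumes "finite_dimensional_vector_space scale Basis"
  shows "normal_category (subspace_cat scale) \<and> bounded_above (subspace_cat scale) \<and>
    (\<exists>\<theta>. order_iso (null_spaces scale) (\<lambda>M N. N \<subseteq> M)
            (cone_classes (subspace_cat scale)) (cone_class_le (subspace_cat scale)) \<theta> \<and>
         connected_category_via (subspace_cat scale) (null_spaces scale) (\<lambda>M N. N \<subseteq> M) \<theta>) \<and>
    isomorphic_as_bounded_above (left_ideal_cat (LT_sgrp scale)) (subspace_cat scale)"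
proof -
  interpret finite_dimensional_vector_space scale Basis by fact
  interpret subspace_category scale ..
  interpret V: normal_category \<V> by (rule normal_category_V)
  obtain \<theta> where \<theta>: "order_iso (null_spaces scale) (\<lambda>M N. N \<subseteq> M) (cone_classes \<V>) (cone_class_le \<V>) \<theta>"
    using null_spaces_order_iso by blast
  then have "connected_category_via \<V> (null_spaces scale) (\<lambda>M N. N \<subseteq> M) \<theta>"
    using V.connected_by_all_classes unfolding connected_category_via_def by blast
  then show ?thesis
    using normal_category_V bounded_above_V left_ideal_cat_isomorphic \<theta> by blast
qed

end
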